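(* Let $\mathscr{A}=\{A_1,\ldots,A_m\}$ be an irreducible set of real $d\times d$ matrices with $\rho(\mathscr{A})>0$, let $\gamma(t,s)$ be any averaging function, let $M_0\subset\mathbb{R}^d$ be a centrally symmetric convex body, and let $e\in\mathbb{R}^d$, $e\neq 0$. Define recursively, for $n=0,1,2,\ldots$, \[ \rho_n^{+}=\min\Bigl\{\rho:\ \operatorname{conv}\Bigl(\bigcup_{i}A_iM_n\Bigr)\subseteq \rho M_n\Bigr\},\qquad \rho_n^{-}=\max\Bigl\{\rho:\ \rho M_n\subseteq\operatorname{conv}\Bigl(\bigcup_{i}A_iM_n\Bigr)\Bigr\}, \] \[ \gamma_n=\gamma(\rho_n^{-},\rho_n^{+}),\qquad M_{n+1}=\operatorname{conv}\Bigl(M_n\cup\gamma_n^{-1}\bigcup_{i}A_iM_n\Bigr),\qquad M_{n+1}^{\bullet}=\mu_{n+1}M_{n+1}, \] where $\mu_{n+1}>0$ is chosen so that $e$ belongs to the boundary of $M_{n+1}^{\bullet}$. Then: \begin{enumerate} \item the sequences $\{\rho_n^{+}\}$ and $\{\rho_n^{-}\}$ both converge to $\rho(\mathscr{A})$; \item the sequence of centrally symmetric convex bodies $\{M_n^{\bullet}\}$ converges in the Hausdorff metric to some Dranishnikov--Konyagin body $M^{*}$ of $\mathscr{A}$; \item the sequence $\{\rho_n^{-}\}$ is non-decreasing, the sequence $\{\rho_n^{+}\}$ is non-increasing, and $\rho_n^{-}\le\rho(\mathscr{A})\le\rho_n^{+}$ for $n=1,2,\ldots$. \end{enumerate}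
   Context: A set $\mathscr{A}$ of real $d\times d$ matrices is irreducible if the matrices from $\mathscr{A}$ have no common invariant subspace other than $\{0\}$ and $\mathbb{R}^d$. The joint spectral radius is $\rho(\mathscr{A})=\limsup_{n\to\infty}\max_{\sigma\in\{1,\ldots,m\}^n}\|A_{\sigma_n}\cdots A_{\sigma_1}\|^{1/n}$; it does not depend on the norm. A convex body is a compact convex subset of $\mathbb{R}^d$ with nonempty interior; $M$ is centrally symmetric if $M=-M$. A Dranishnikov--Konyagin body of $\mathscr{A}$ is a convex body $M$ such that $\rho M=\operatorname{conv}\bigl(\bigcup_i A_iM\bigr)$ for some $\rho>0$. An averaging function is a continuous function $\gamma(t,s)$, $t,s>0$, such that $\gamma(t,t)=t$ and $\min\{t,s\}<\gamma(t,s)<\max\{t,s\}$ for $t\ne s$. *)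

theory Defs
  imports "HOL-Analysis.Analysis"
begin

definition irreducible_matrices :: "(real^'d^'d) set \<Rightarrow> bool" where
  "irreducible_matrices \<A> \<longleftrightarrow>
     (\<forall>L. subspace L \<and> (\<forall>A\<in>\<A>. (*v) A ` L \<subseteq> L) \<longrightarrow> L = {0} \<or> L = UNIV)"

text \<open>The library norm on \<^typ>\<open>real^'d^'d\<close> is the Frobenius norm; the joint spectral radius
  is defined with the operator norm, but does not depend on this choice. A list stands for the
  word of its entries, and the maximum ranges over all words of length \<open>n\<close> over \<open>\<A>\<close>. For
  finite nonempty \<open>\<A>\<close> the sequence is bounded, so the limsup is finite and \<^const>\<open>real_of_ereal\<close>
  loses nothing.\<close>

definition matrix_word :: "(real^'d^'d) list \<Rightarrow> real^'d^'d" where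
  "matrix_word w = foldr (**) w (mat 1)"

definition joint_spectral_radius :: "(real^'d^'d) set \<Rightarrow> real" where
  "joint_spectral_radius \<A> = real_of_ereal (limsup (\<lambda>n. ereal
     (MAX w\<in>{w. set w \<subseteq> \<A> \<and> length w = n}. onorm ((*v) (matrix_word w)) powr (1 / real n))))"

definition convex_body :: "'a::euclidean_space set \<Rightarrow> bool" where
  "convex_body M \<longleftrightarrow> compact M \<and> convex M \<and> interior M \<noteq> {}"

definition centrally_symmetric :: "'a::real_vector set \<Rightarrow> bool" where
  "centrally_symmetric M \<longleftrightarrow> M = uminus ` M"

definition union_image :: "(real^'d^'d) set \<Rightarrow> (real^'d) set \<Rightarrow> (real^'d) set" where
  "union_image \<A> M = (\<Union>A\<in>\<A>. (*v) A ` M)"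

definition DK_body :: "(real^'d^'d) set \<Rightarrow> (real^'d) set \<Rightarrow> bool" where
  "DK_body \<A> M \<longleftrightarrow>
     convex_body M \<and> (\<exists>r>0. (*\<^sub>R) r ` M = convex hull (union_image \<A> M))"

definition averaging_function :: "(real \<Rightarrow> real \<Rightarrow> real) \<Rightarrow> bool" where
  "averaging_function \<gamma> \<longleftrightarrow>
     continuous_on ({0<..} \<times> {0<..}) (\<lambda>(t, s). \<gamma> t s) \<and>
     (\<forall>t>0. \<gamma> t t = t) \<and>
     (\<forall>t>0. \<forall>s>0. t \<noteq> s \<longrightarrow> min t s < \<gamma> t s \<and> \<gamma> t s < max t s)"

text \<open>The minimum and maximum are over nonnegative scaling factors: for \<open>M = -M\<close> the factors \<open>r\<close>
  and \<open>-r\<close> give the same set, so over all reals the minimum would not exist.\<close>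

definition rho_plus :: "(real^'d^'d) set \<Rightarrow> (real^'d) set \<Rightarrow> real" where
  "rho_plus \<A> M = (LEAST r. 0 \<le> r \<and> convex hull (union_image \<A> M) \<subseteq> (*\<^sub>R) r ` M)"

definition rho_minus :: "(real^'d^'d) set \<Rightarrow> (real^'d) set \<Rightarrow> real" where
  "rho_minus \<A> M = (GREATEST r. 0 \<le> r \<and> (*\<^sub>R) r ` M \<subseteq> convex hull (union_image \<A> M))"

primrec relax_body ::
    "(real^'d^'d) set \<Rightarrow> (real \<Rightarrow> real \<Rightarrow> real) \<Rightarrow> (real^'d) set \<Rightarrow> nat \<Rightarrow> (real^'d) set" where
  "relax_body \<A> \<gamma> M\<^sub>0 0 = M\<^sub>0"
| "relax_body \<A> \<gamma> M\<^sub>0 (Suc n) =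
    (let M = relax_body \<A> \<gamma> M\<^sub>0 n;
         g = \<gamma> (rho_minus \<A> M) (rho_plus \<A> M)
     in convex hull (M \<union> (*\<^sub>R) (inverse g) ` union_image \<A> M))"

text \<open>The Hausdorff distance; a metric on nonempty compact sets.\<close>

definition hausdorff_dist :: "'a::metric_space set \<Rightarrow> 'a set \<Rightarrow> real" where
  "hausdorff_dist S T = max (SUP x\<in>S. infdist x T) (SUP y\<in>T. infdist y S)"

end

theory Submission
  imports Defs "HOL-Complex_Analysis.Great_Picard"
begin

text \<open>A convex body is encoded by its support function \<open>h\<close>. Passing from \<open>M\<close> to the convex hull of
  the union of the images \<open>A M\<close> replaces \<open>h\<close> by \<open>T h = max h(A\<^sup>T x)\<close>, so the relaxation becomes
  \<open>h\<^sub>n\<^sub>+\<^sub>1 = max(h\<^sub>n, T h\<^sub>n / \<gamma>\<^sub>n)\<close>, and the two bounds are the extreme values of \<open>T h\<^sub>n / h\<^sub>n\<close>. They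
  are monotone and enclose the joint spectral radius, and irreducibility bounds the eccentricity of all
  norms \<open>h\<close> with \<open>T h \<le> R h\<close>.

  If the limits of the bounds differed, the limit of \<open>\<gamma>\<^sub>n\<close> would lie strictly between them. A
  minimizer of \<open>T h\<^sub>n / h\<^sub>n\<close> is then untouched by all but finitely many earlier steps, so \<open>h\<^sub>n\<close> stays
  bounded, whereas at the maximizers it would have to grow by a fixed factor at each step.

  Hence any limit point \<open>f\<close> of the normalized \<open>h\<^sub>n\<close> satisfies \<open>T f = \<rho> f\<close>. A relaxation step maps
  multiples of \<open>f\<close> to multiples of \<open>f\<close> and is monotone, so once \<open>h\<^sub>n\<close> is projectively close to \<open>f\<close> it
  remains so; this gives convergence of the whole normalized sequence.\<close>

section \<open>Seminorms\<close>

text \<open>Homogeneity with \<open>\<bar>c\<bar>\<close> matches central symmetry of bodies.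
  Definiteness is left out so that the notion survives pointwise limits; positivity off 0 is added
  separately.\<close>

definition seminorm_on_space :: "('a::real_vector \<Rightarrow> real) \<Rightarrow> bool" where
  "seminorm_on_space f \<longleftrightarrow>
     (\<forall>x y. f (x + y) \<le> f x + f y) \<and> (\<forall>c x. f (c *\<^sub>R x) = \<bar>c\<bar> * f x)"

lemma seminorm_add: "seminorm_on_space f \<Longrightarrow> f (x + y) \<le> f x + f y"
  and seminorm_scaleR: "seminorm_on_space f \<Longrightarrow> f (c *\<^sub>R x) = \<bar>c\<bar> * f x"
  by (auto simp: seminorm_on_space_def)

lemma seminorm_zero: "seminorm_on_space f \<Longrightarrow> f 0 = 0"
  using seminorm_scaleR[of f 0 0] by simp

lemma seminorm_minus: "seminorm_on_space f \<Longrightarrow> f (- x) = f x"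
  using seminorm_scaleR[of f "-1" x] by simp

lemma seminorm_nonneg:
  assumes "seminorm_on_space f" shows "0 \<le> f x"
  using seminorm_add[OF assms, of x "- x"] seminorm_zero[OF assms] seminorm_minus[OF assms, of x]
  by simp

lemma seminorm_abs_diff:
  assumes "seminorm_on_space f" shows "\<bar>f x - f y\<bar> \<le> f (x - y)"
  using seminorm_add[OF assms, of "x - y" y] seminorm_add[OF assms, of "y - x" x]
    seminorm_minus[OF assms, of "x - y"] by simp

lemma seminorm_divide:
  assumes "seminorm_on_space f" "0 \<le> s" shows "seminorm_on_space (\<lambda>x. f x / s)"
  unfolding seminorm_on_space_def
proof (intro conjI allI)
  show "f (x + y) / s \<le> f x / s + f y / s" for x y
    using divide_right_mono[OF seminorm_add[OF assms(1)] assms(2), of x y]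
    by (simp add: add_divide_distrib)
qed (simp add: seminorm_scaleR[OF assms(1)])

section \<open>Comparison with the Euclidean norm, continuity and compactness of seminorms\<close>

lemma seminorm_normalize:
  fixes f :: "'a::real_normed_vector \<Rightarrow> real"
  assumes "seminorm_on_space f" shows "f x = norm x * f (x /\<^sub>R norm x)"
  by (cases "x = 0") (simp_all add: seminorm_scaleR[OF assms] seminorm_zero[OF assms])

lemma seminorm_upper_bound:
  fixes f :: "'a::euclidean_space \<Rightarrow> real"
  assumes f: "seminorm_on_space f"
  obtains C where "C > 0" "\<And>x. f x \<le> C * norm x"
proof
  \<comment> \<open>The summand 1 keeps the constant positive when \<open>f\<close> vanishes
    identically.\<close>
  let ?C = "(\<Sum>b\<in>Basis. f b) + 1"
  have nn: "(\<Sum>b\<in>Basis. f b) \<ge> 0"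
    by (intro sum_nonneg seminorm_nonneg f)
  then show "?C > 0" by simp
  fix x
  have sub: "f (\<Sum>b\<in>B. g b) \<le> (\<Sum>b\<in>B. f (g b))" if "finite B" for B and g :: "'a \<Rightarrow> 'a"
    using that
  proof induction
    case empty then show ?case by (simp add: seminorm_zero[OF f])
  next
    case (insert b B)
    then show ?case using seminorm_add[OF f, of "g b" "sum g B"] by simp
  qed
  have "f x = f (\<Sum>b\<in>Basis. (x \<bullet> b) *\<^sub>R b)" by (simp add: euclidean_representation)
  also have "\<dots> \<le> (\<Sum>b\<in>Basis. f ((x \<bullet> b) *\<^sub>R b))" by (rule sub) simp
  also have "\<dots> \<le> (\<Sum>b\<in>Basis. norm x * f b)"
    by (intro sum_mono)
      (auto simp: seminorm_scaleR[OF f] Basis_le_norm intro!: mult_right_mono seminorm_nonneg[OF f])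
  also have "\<dots> \<le> ?C * norm x"
    by (simp add: sum_distrib_left[symmetric] algebra_simps)
  finally show "f x \<le> ?C * norm x" .
qed

lemma seminorm_continuous:
  fixes f :: "'a::euclidean_space \<Rightarrow> real"
  assumes f: "seminorm_on_space f"
  shows "continuous_on S f"
proof -
  obtain C where C: "C > 0" "\<And>x. f x \<le> C * norm x" using seminorm_upper_bound[OF f] by blast
  have "C-lipschitz_on S f"
    using C seminorm_abs_diff[OF f]
    by (auto simp: lipschitz_on_def dist_norm intro: order_trans)
  then show ?thesis by (rule lipschitz_on_continuous_on)
qed

text \<open>The continuous function \<open>f\<close> attains a positive minimum on the unit sphere,
  and homogeneity extends the bound to all vectors.\<close>

lemma seminorm_lower_bound:
  fixes f :: "'a::euclidean_space \<Rightarrow> real"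
  assumes f: "seminorm_on_space f" and pos: "\<And>x. x \<noteq> 0 \<Longrightarrow> f x > 0"
  obtains c where "c > 0" "\<And>x. c * norm x \<le> f x"
proof -
  have ne: "sphere (0::'a) 1 \<noteq> {}" by simp
  obtain z where z: "norm z = 1" "\<And>x. norm x = 1 \<Longrightarrow> f z \<le> f x"
    using continuous_attains_inf[OF compact_sphere ne seminorm_continuous[OF f]] by auto
  have "f z * norm x \<le> f x" for x
  proof (cases "x = 0")
    case False
    then have "f z \<le> f (x /\<^sub>R norm x)" by (intro z) simp
    then show ?thesis
      by (subst (2) seminorm_normalize[OF f]) (simp add: mult.commute mult_left_mono)
  qed (simp add: seminorm_zero[OF f])
  moreover have "f z > 0" using z(1) by (intro pos) auto
  ultimately show thesis using that by blast
qed

lemma seminorm_pointwise_limit: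
  assumes "\<And>n. seminorm_on_space (g n)" and lim: "\<And>x. (\<lambda>n. g n x) \<longlonglongrightarrow> f x"
  shows "seminorm_on_space f"
  unfolding seminorm_on_space_def
proof (intro conjI allI)
  show "f (x + y) \<le> f x + f y" for x y
    by (rule LIMSEQ_le[OF lim tendsto_add[OF lim lim]]) (auto intro: seminorm_add assms)
  have "(\<lambda>n. g n (c *\<^sub>R x)) \<longlonglongrightarrow> \<bar>c\<bar> * f x" for c x
    unfolding seminorm_scaleR[OF assms(1)] by (intro tendsto_intros lim)
  then show "f (c *\<^sub>R x) = \<bar>c\<bar> * f x" for c x
    using lim LIMSEQ_unique by blast
qed

text \<open>The common bound makes the family equi-Lipschitz, so Arzela-Ascoli applies on the unit
  sphere. Homogeneity extends the limit to the whole space and turns the uniform error into a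
  multiple of the norm.\<close>

lemma seminorm_compactness:
  fixes g :: "nat \<Rightarrow> 'a::euclidean_space \<Rightarrow> real"
  assumes g: "\<And>n. seminorm_on_space (g n)" and bd: "\<And>n x. g n x \<le> C * norm x"
  obtains f r where "seminorm_on_space f" "strict_mono (r :: nat \<Rightarrow> nat)"
    "\<And>x. (\<lambda>n. g (r n) x) \<longlonglongrightarrow> f x"
    "\<And>e. e > 0 \<Longrightarrow> \<forall>\<^sub>F n in sequentially. \<forall>x. \<bar>g (r n) x - f x\<bar> \<le> e * norm x"
proof -
  \<comment> \<open>\<open>C\<close> need not be positive, whereas the Lipschitz constant is used as
    a divisor in \<open>e / C'\<close>.\<close>
  define C' where "C' = \<bar>C\<bar> + 1"
  have C': "C' > 0" "\<And>n x. g n x \<le> C' * norm x"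
    by (auto simp: C'_def intro!: order_trans[OF bd] mult_right_mono)
  have lip: "\<bar>g n x - g n y\<bar> \<le> C' * norm (x - y)" for n x y
    using seminorm_abs_diff[OF g] C'(2) order_trans by blast
  obtain h r where r: "strict_mono (r :: nat \<Rightarrow> nat)" and
    conv: "\<And>e. 0 < e \<Longrightarrow> \<exists>N. \<forall>n x. n \<ge> N \<and> x \<in> sphere 0 1 \<longrightarrow> norm (g (r n) x - h x) < e"
  proof (rule Arzela_Ascoli[of "sphere (0::'a) 1" g C'])
    show "norm (g n x) \<le> C'" if "x \<in> sphere 0 1" for n x
      using C'(2)[of n x] seminorm_nonneg[OF g, of n x] that by simp
    show "\<exists>d>0. \<forall>n y. y \<in> sphere 0 1 \<and> norm (x - y) < d \<longrightarrow> norm (g n x - g n y) < e"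
      if "0 < e" for x e
    proof (intro exI[of _ "e / C'"] conjI allI impI)
      show "norm (g n x - g n y) < e" if "y \<in> sphere 0 1 \<and> norm (x - y) < e / C'" for n y
        using lip[of n x y] that C'(1) by (simp add: pos_less_divide_eq mult.commute)
    qed (use that C' in auto)
  qed (auto simp: that)
  \<comment> \<open>Homogeneous extension of the limit on the sphere; the factor
    \<open>norm x\<close> makes it vanish at 0.\<close>
  define f where "f = (\<lambda>x. norm x * h (x /\<^sub>R norm x))"
  have unif: "\<forall>\<^sub>F n in sequentially. \<forall>x. \<bar>g (r n) x - f x\<bar> \<le> e * norm x" if e: "e > 0" for e
  proof -
    obtain N where N: "\<And>n x. n \<ge> N \<Longrightarrow> norm x = 1 \<Longrightarrow> \<bar>g (r n) x - h x\<bar> < e"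
      using conv[OF e] by auto
    have "\<bar>g (r n) x - f x\<bar> \<le> e * norm x" if n: "n \<ge> N" for n x
    proof (cases "x = 0")
      case True then show ?thesis by (simp add: f_def seminorm_zero[OF g])
    next
      case False
      have "g (r n) x - f x = norm x * (g (r n) (x /\<^sub>R norm x) - h (x /\<^sub>R norm x))"
        unfolding f_def by (subst seminorm_normalize[OF g]) (simp add: algebra_simps)
      then show ?thesis
        using N[OF n, of "x /\<^sub>R norm x"] False
        by (simp add: abs_mult mult.commute mult_left_mono less_imp_le)
    qed
    then show ?thesis by (auto simp: eventually_sequentially)
  qed
  have lim: "(\<lambda>n. g (r n) x) \<longlonglongrightarrow> f x" for x
  proof (rule LIMSEQ_I)
    fix e :: real assume "e > 0"
    \<comment> \<open>The denominator \<open>norm x + 1\<close> covers \<open>x = 0\<close> and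
      leaves room for a strict inequality.\<close>
    then have e: "e / (norm x + 1) > 0" by (simp add: add_nonneg_pos)
    have "e / (norm x + 1) * norm x < e"
      using \<open>e > 0\<close> by (simp add: pos_divide_less_eq add_nonneg_pos)
    with unif[OF e] show "\<exists>no. \<forall>n\<ge>no. norm (g (r n) x - f x) < e"
      unfolding eventually_sequentially real_norm_def by (meson le_less_trans)
  qed
  have "seminorm_on_space f"
    using seminorm_pointwise_limit[of "\<lambda>n. g (r n)" f] g lim by auto
  with r lim unif show thesis using that by blast
qed

section \<open>Irreducible sets acting on seminorms\<close>

text \<open>Since \<^term>\<open>x v* A\<close> is the transpose of \<^term>\<open>A\<close> applied to \<^term>\<open>x\<close>, this is the action
  on support functions of the map sending a body to the union of its images.\<close>

definition max_image :: "(real^'d^'d) set \<Rightarrow> (real^'d \<Rightarrow> real) \<Rightarrow> real^'d \<Rightarrow> real" where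
  "max_image \<A> h x = (MAX A\<in>\<A>. h (x v* A))"

section \<open>Order, seminorm and scaling properties of \<open>max_image\<close>\<close>

lemma max_image_ge: "finite \<A> \<Longrightarrow> A \<in> \<A> \<Longrightarrow> h (x v* A) \<le> max_image \<A> h x"
  by (simp add: max_image_def)

lemma max_image_attained:
  assumes "finite \<A>" "\<A> \<noteq> {}"
  obtains A where "A \<in> \<A>" "max_image \<A> h x = h (x v* A)"
proof -
  have "Max ((\<lambda>A. h (x v* A)) ` \<A>) \<in> (\<lambda>A. h (x v* A)) ` \<A>"
    using assms by (intro Max_in) auto
  then show thesis using that by (auto simp: max_image_def)
qed

lemma max_image_mono:
  assumes "finite \<A>" "\<A> \<noteq> {}" "\<And>y. h y \<le> k y"
  shows "max_image \<A> h x \<le> max_image \<A> k x"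
  using max_image_attained[OF assms(1,2), of h x] max_image_ge[OF assms(1), of _ k x] assms(3)
  by (metis order_trans)

lemma seminorm_max_image:
  fixes \<A> :: "(real^'d^'d) set"
  assumes \<A>: "finite \<A>" "\<A> \<noteq> {}" and h: "seminorm_on_space h"
  shows "seminorm_on_space (max_image \<A> h)"
  unfolding seminorm_on_space_def
proof (intro conjI allI)
  fix x y :: "real^'d"
  obtain A where A: "A \<in> \<A>" "max_image \<A> h (x + y) = h ((x + y) v* A)"
    using max_image_attained[OF \<A>, of h "x + y"] by blast
  have "h ((x + y) v* A) \<le> h (x v* A) + h (y v* A)"
    by (simp add: vector_matrix_left_distrib seminorm_add[OF h])
  then show "max_image \<A> h (x + y) \<le> max_image \<A> h x + max_image \<A> h y"
    using max_image_ge[OF \<A>(1) A(1), of h x] max_image_ge[OF \<A>(1) A(1), of h y] A(2) by linarith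
next
  fix c :: real and x :: "real^'d"
  have "mono (\<lambda>y. \<bar>c\<bar> * y)" by (intro monoI mult_left_mono) auto
  from mono_Max_commute[OF this, of "(\<lambda>A. h (x v* A)) ` \<A>"] \<A>
  show "max_image \<A> h (c *\<^sub>R x) = \<bar>c\<bar> * max_image \<A> h x"
    by (simp add: max_image_def image_image scaleR_vector_matrix_assoc seminorm_scaleR[OF h])
qed

lemma max_image_scale:
  assumes "finite \<A>" "\<A> \<noteq> {}" "c \<ge> 0"
  shows "max_image \<A> (\<lambda>x. c * h x) x = c * max_image \<A> h x"
proof -
  have "mono (\<lambda>y. c * y)" using assms by (intro monoI mult_left_mono) auto
  from mono_Max_commute[OF this, of "(\<lambda>A. h (x v* A)) ` \<A>"] assms
  show ?thesis by (simp add: max_image_def image_image)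
qed

text \<open>Irreducibility speaks of the matrices, but support functions see their transposes. The
  orthogonal complement of a subspace invariant under the transposes is invariant under the
  matrices.\<close>

lemma irreducible_left_invariant:
  fixes \<A> :: "(real^'d^'d) set"
  assumes irr: "irreducible_matrices \<A>" and L: "subspace L"
    and inv: "\<And>A x. A \<in> \<A> \<Longrightarrow> x \<in> L \<Longrightarrow> x v* A \<in> L"
  shows "L = {0} \<or> L = UNIV"
proof -
  have "(*v) A ` (L\<^sup>\<bottom>) \<subseteq> L\<^sup>\<bottom>" if "A \<in> \<A>" for A
  proof clarify
    fix y assume y: "y \<in> L\<^sup>\<bottom>"
    have "x \<bullet> (A *v y) = 0" if "x \<in> L" for x
      using inv[OF \<open>A \<in> \<A>\<close> that] y
      by (simp add: orthogonal_comp_def orthogonal_def dot_lmul_matrix[symmetric])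
    then show "A *v y \<in> L\<^sup>\<bottom>" by (simp add: orthogonal_comp_def orthogonal_def)
  qed
  moreover have "subspace (L\<^sup>\<bottom>)" by (rule subspace_orthogonal_comp)
  ultimately have "L\<^sup>\<bottom> = {0} \<or> L\<^sup>\<bottom> = UNIV"
    using irr unfolding irreducible_matrices_def by blast
  then show ?thesis
    using orthogonal_comp_self[OF L] by (metis orthogonal_comp_null orthogonal_comp_UNIV)
qed

text \<open>The kernel of \<open>f\<close> is a subspace invariant under the transposes, and
  \<open>f y \<noteq> 0\<close> excludes that it is the whole space.\<close>

lemma irreducible_seminorm_pos:
  fixes \<A> :: "(real^'d^'d) set"
  assumes irr: "irreducible_matrices \<A>" and f: "seminorm_on_space f"
    and le: "\<And>A x. A \<in> \<A> \<Longrightarrow> f (x v* A) \<le> R * f x"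
    and "f y \<noteq> 0" "x \<noteq> 0"
  shows "f x > 0"
proof -
  have "subspace {x. f x = 0}"
    unfolding subspace_def
  proof (intro conjI ballI allI)
    show "x + y \<in> {x. f x = 0}" if "x \<in> {x. f x = 0}" "y \<in> {x. f x = 0}" for x y
      using that seminorm_add[OF f, of x y] seminorm_nonneg[OF f, of "x + y"] by simp
  qed (simp_all add: seminorm_zero[OF f] seminorm_scaleR[OF f])
  moreover have "x v* A \<in> {x. f x = 0}" if "A \<in> \<A>" "x \<in> {x. f x = 0}" for A x
    using le[OF that(1), of x] that(2) seminorm_nonneg[OF f, of "x v* A"] by simp
  ultimately have "{x. f x = 0} = {0} \<or> {x. f x = 0} = UNIV"
    by (rule irreducible_left_invariant[OF irr])
  with \<open>f y \<noteq> 0\<close> \<open>x \<noteq> 0\<close> have "f x \<noteq> 0" by blast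
  with seminorm_nonneg[OF f, of x] show ?thesis by simp
qed

text \<open>Otherwise a limit of normalized seminorms would be a nonzero seminorm whose kernel is a
  nontrivial invariant subspace.\<close>

lemma irreducible_eccentricity:
  fixes \<A> :: "(real^'d^'d) set"
  assumes irr: "irreducible_matrices \<A>"
  obtains C where "C > 0"
    "\<And>f x y. seminorm_on_space f \<Longrightarrow> (\<And>A x. A \<in> \<A> \<Longrightarrow> f (x v* A) \<le> R * f x) \<Longrightarrow>
        f y * norm x \<le> C * f x * norm y"
proof (rule ccontr)
  assume neg: "\<not> thesis"
  note witness = that
  define P where "P = (\<lambda>f. seminorm_on_space f \<and> (\<forall>A\<in>\<A>. \<forall>x. f (x v* A) \<le> R * f x))"
  \<comment> \<open>Failure of the constant \<open>Suc n\<close> yields, after division by the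
    maximum on the unit sphere, a seminorm with maximum 1 there and a value of at most
    \<open>1 / Suc n\<close> at some unit vector.\<close>
  have ex: "\<exists>f x z. P f \<and> (\<forall>y. f y \<le> norm y) \<and> norm x = 1 \<and> norm z = 1 \<and> f z = 1 \<and> f x \<le> inverse (real (Suc n))" for n
  proof -
    obtain f x y where f: "P f" and fxy: "f y * norm x > real (Suc n) * f x * norm y"
      using neg witness[of "real (Suc n)"] unfolding P_def
      by (metis not_le of_nat_0_less_iff zero_less_Suc)
    have sn: "seminorm_on_space f" using f by (simp add: P_def)
    have xy: "x \<noteq> 0" "y \<noteq> 0" using fxy by (auto simp: seminorm_zero[OF sn])
    have ne: "sphere (0::real^'d) 1 \<noteq> {}" by simp
    obtain z where z: "norm z = 1" "\<And>u. norm u = 1 \<Longrightarrow> f u \<le> f z"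
      using continuous_attains_sup[OF compact_sphere ne seminorm_continuous[OF sn]] by auto
    have le: "f u \<le> f z * norm u" for u
    proof (cases "u = 0")
      case False
      then show ?thesis using z(2)[of "u /\<^sub>R norm u"]
        by (subst seminorm_normalize[OF sn]) (simp add: mult.commute mult_left_mono)
    qed (simp add: seminorm_zero[OF sn])
    have "0 \<le> real (Suc n) * f x * norm y" by (simp add: seminorm_nonneg[OF sn])
    with fxy have "f y * norm x > 0" by linarith
    then have fy: "f y > 0" using seminorm_nonneg[OF sn, of y] by (simp add: zero_less_mult_iff)
    with le[of y] have fz: "f z > 0"
      by (metis less_le_trans mult_nonpos_nonneg norm_ge_zero not_le)
    have "real (Suc n) * f x * norm y < f z * norm y * norm x"
      using fxy mult_right_mono[OF le[of y] norm_ge_zero[of x]] by linarith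
    then have "real (Suc n) * f x < f z * norm x"
      using xy(2) by (simp add: mult.commute mult.left_commute)
    then have "real (Suc n) * (f x / norm x) \<le> f z"
      using xy(1) by (simp add: pos_divide_le_eq)
    then have "f (x /\<^sub>R norm x) \<le> inverse (real (Suc n)) * f z"
      by (simp add: seminorm_scaleR[OF sn] inverse_eq_divide pos_le_divide_eq mult.commute)
    then have small: "f (x /\<^sub>R norm x) / f z \<le> inverse (real (Suc n))"
      using fz by (subst pos_divide_le_eq)
    show ?thesis
    proof (intro exI conjI)
      show "P (\<lambda>x. f x / f z)"
        using f fz by (auto simp: P_def seminorm_divide divide_right_mono)
      show "\<forall>y. f y / f z \<le> norm y" using le fz by (simp add: pos_divide_le_eq mult.commute)
      show "f (x /\<^sub>R norm x) / f z \<le> inverse (real (Suc n))" by (rule small)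
    qed (use z fz xy in auto)
  qed
  then obtain f x z where f: "\<And>n. P (f n)" and bd: "\<And>n y. f n y \<le> 1 * norm y"
    and x: "\<And>n. norm (x n) = 1" and z: "\<And>n. norm (z n) = 1" "\<And>n. f n (z n) = 1"
    and fx: "\<And>n. f n (x n) \<le> inverse (real (Suc n))"
    unfolding mult_1 by metis
  have sn: "seminorm_on_space (f n)" for n using f by (simp add: P_def)
  obtain r1 x' where x': "x' \<in> sphere 0 1" "strict_mono r1" "(x \<circ> r1) \<longlonglongrightarrow> x'"
    using compact_sphere[of "0::real^'d" 1, unfolded compact_def, rule_format, of x] x by auto
  obtain r2 z' where z': "z' \<in> sphere 0 1" "strict_mono r2" "(z \<circ> r1 \<circ> r2) \<longlonglongrightarrow> z'"
    using compact_sphere[of "0::real^'d" 1, unfolded compact_def, rule_format, of "z \<circ> r1"] z(1) by auto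
  \<comment> \<open>Both sequences of unit vectors and the seminorms must converge along one
    subsequence, hence three successive extractions.\<close>
  define s where "s = r1 \<circ> r2"
  obtain k r3 where k: "seminorm_on_space k" "strict_mono (r3 :: nat \<Rightarrow> nat)"
    "\<And>x. (\<lambda>n. f (s (r3 n)) x) \<longlonglongrightarrow> k x"
    using seminorm_compactness[of "\<lambda>n. f (s n)" 1] sn bd by metis
  define t where "t = s \<circ> r3"
  have t: "strict_mono t" unfolding t_def s_def using x'(2) z'(2) k(2) by (intro strict_mono_o)
  have kt: "(\<lambda>n. f (t n) x) \<longlonglongrightarrow> k x" for x using k(3)[of x] by (simp add: t_def)
  have xt: "(\<lambda>n. x (t n)) \<longlonglongrightarrow> x'"
    using LIMSEQ_subseq_LIMSEQ[OF x'(3), of "r2 \<circ> r3"] z'(2) k(2)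
    by (simp add: t_def s_def o_def strict_mono_o[unfolded o_def])
  have zt: "(\<lambda>n. z (t n)) \<longlonglongrightarrow> z'"
    using LIMSEQ_subseq_LIMSEQ[OF z'(3), of "r3"] k(2) by (simp add: t_def s_def o_def)
  \<comment> \<open>All \<open>f n\<close> are 1-Lipschitz because they are bounded by the norm, so
    the argument may converge together with the seminorm.\<close>
  have moving: "(\<lambda>n. f (t n) (u n)) \<longlonglongrightarrow> k u'" if u: "u \<longlonglongrightarrow> u'" for u u'
  proof -
    have "(\<lambda>n. f (t n) (u n) - f (t n) u') \<longlonglongrightarrow> 0"
    proof (rule Lim_null_comparison)
      show "\<forall>\<^sub>F n in sequentially. norm (f (t n) (u n) - f (t n) u') \<le> norm (u n - u')"
        using order_trans[OF seminorm_abs_diff[OF sn] bd]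
        by (intro always_eventually allI) simp
      show "(\<lambda>n. norm (u n - u')) \<longlonglongrightarrow> 0"
        using u by (simp add: tendsto_norm_zero_iff LIM_zero_iff)
    qed
    from tendsto_add[OF this kt[of u']] show ?thesis by simp
  qed
  have "k z' = 1" using moving[OF zt] z(2) by (simp add: LIMSEQ_const_iff)
  moreover have "k x' \<le> 0"
  proof (rule LIMSEQ_le[OF moving[OF xt]])
    show "(\<lambda>n. inverse (real (Suc (t n)))) \<longlonglongrightarrow> 0"
      using LIMSEQ_subseq_LIMSEQ[OF LIMSEQ_inverse_real_of_nat t] by (simp add: o_def)
  qed (use fx in auto)
  moreover have "k (x v* A) \<le> R * k x" if "A \<in> \<A>" for A x
    by (rule LIMSEQ_le[OF kt tendsto_mult_left[OF kt]]) (use f that in \<open>auto simp: P_def\<close>)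
  moreover have "x' \<noteq> 0" using x'(1) by auto
  ultimately show False
    using irreducible_seminorm_pos[OF irr k(1), of R z' x'] by force
qed

text \<open>The quotient is constant along rays and continuous on the compact unit sphere. The
  attaining vector is what later reduces comparisons of extreme ratios to a single
  direction.\<close>

lemma seminorm_ratio_max:
  fixes h k :: "'a::euclidean_space \<Rightarrow> real"
  assumes h: "seminorm_on_space h" and pos: "\<And>x. x \<noteq> 0 \<Longrightarrow> h x > 0" and k: "seminorm_on_space k"
  obtains q x where "q \<ge> 0" "\<And>x. k x \<le> q * h x" "x \<noteq> 0" "k x = q * h x"
proof -
  have ne: "sphere (0::'a) 1 \<noteq> {}" by simp
  have pos': "h u > 0" if "norm u = 1" for u using that by (intro pos) auto
  have "continuous_on (sphere 0 1) (\<lambda>x. k x / h x)"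
    using pos' by (intro continuous_intros seminorm_continuous h k) force
  from continuous_attains_sup[OF compact_sphere ne this]
  obtain z where z: "norm z = 1" "\<And>u. norm u = 1 \<Longrightarrow> k u / h u \<le> k z / h z" by auto
  show thesis
  proof (rule that[of "k z / h z" z])
    show "k x \<le> k z / h z * h x" for x
    proof (cases "x = 0")
      case False
      then have "k (x /\<^sub>R norm x) / h (x /\<^sub>R norm x) \<le> k z / h z" by (intro z) simp
      then show ?thesis
        using False pos[of x] by (simp add: seminorm_scaleR[OF h] seminorm_scaleR[OF k] pos_divide_le_eq)
    qed (simp add: seminorm_zero[OF h] seminorm_zero[OF k])
  qed (use z pos'[OF z(1)] seminorm_nonneg[OF k, of z] in auto)
qed

lemma seminorm_ratio_min:
  fixes h k :: "'a::euclidean_space \<Rightarrow> real"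
  assumes h: "seminorm_on_space h" and pos: "\<And>x. x \<noteq> 0 \<Longrightarrow> h x > 0" and k: "seminorm_on_space k"
  obtains p x where "p \<ge> 0" "\<And>x. p * h x \<le> k x" "x \<noteq> 0" "k x = p * h x"
proof -
  have ne: "sphere (0::'a) 1 \<noteq> {}" by simp
  have pos': "h u > 0" if "norm u = 1" for u using that by (intro pos) auto
  have "continuous_on (sphere 0 1) (\<lambda>x. k x / h x)"
    using pos' by (intro continuous_intros seminorm_continuous h k) force
  from continuous_attains_inf[OF compact_sphere ne this]
  obtain z where z: "norm z = 1" "\<And>u. norm u = 1 \<Longrightarrow> k z / h z \<le> k u / h u" by auto
  show thesis
  proof (rule that[of "k z / h z" z])
    show "k z / h z * h x \<le> k x" for x
    proof (cases "x = 0")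
      case False
      then have "k z / h z \<le> k (x /\<^sub>R norm x) / h (x /\<^sub>R norm x)" by (intro z) simp
      then show ?thesis
        using False pos[of x] by (simp add: seminorm_scaleR[OF h] seminorm_scaleR[OF k] pos_le_divide_eq)
    qed (simp add: seminorm_zero[OF h] seminorm_zero[OF k])
  qed (use z pos'[OF z(1)] seminorm_nonneg[OF k, of z] in auto)
qed

section \<open>Relaxation of norms\<close>

lemma averaging_strictly_between:
  assumes "averaging_function \<gamma>" "0 < t" "t < s"
  shows "t < \<gamma> t s" and "\<gamma> t s < s"
proof -
  have "min t s < \<gamma> t s \<and> \<gamma> t s < max t s"
    using assms unfolding averaging_function_def by (metis less_irrefl less_trans)
  then show "t < \<gamma> t s" "\<gamma> t s < s" using assms(3) by auto
qed

lemma averaging_between: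
  assumes "averaging_function \<gamma>" "0 < t" "t \<le> s"
  shows "t \<le> \<gamma> t s" and "\<gamma> t s \<le> s"
proof -
  have "\<gamma> t t = t" using assms(1,2) by (simp add: averaging_function_def)
  then show "t \<le> \<gamma> t s" "\<gamma> t s \<le> s"
    using averaging_strictly_between[OF assms(1,2), of s] assms(3) by (cases "t = s"; simp)+
qed

text \<open>The iteration seen through support functions: \<open>p n\<close> and \<open>q n\<close>
  are the attained extreme ratios of \<open>max_image \<A> (h n)\<close> to \<open>h n\<close>. The
  number \<open>\<rho>\<close> enters only as a value enclosed by all these bounds.\<close>

locale relaxation =
  fixes \<A> :: "(real^'d^'d) set"
    and \<gamma> :: "real \<Rightarrow> real \<Rightarrow> real"
    and h :: "nat \<Rightarrow> real^'d \<Rightarrow> real"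
    and p q :: "nat \<Rightarrow> real"
    and \<rho> :: real
  assumes fin: "finite \<A>" and ne: "\<A> \<noteq> {}"
    and irr: "irreducible_matrices \<A>"
    and avg: "averaging_function \<gamma>"
    and sn: "\<And>n. seminorm_on_space (h n)"
    and pos: "\<And>n x. x \<noteq> 0 \<Longrightarrow> h n x > 0"
    and lower: "\<And>n x. p n * h n x \<le> max_image \<A> (h n) x"
    and lower_attained: "\<And>n. \<exists>x. x \<noteq> 0 \<and> max_image \<A> (h n) x = p n * h n x"
    and upper: "\<And>n x. max_image \<A> (h n) x \<le> q n * h n x"
    and upper_attained: "\<And>n. \<exists>x. x \<noteq> 0 \<and> max_image \<A> (h n) x = q n * h n x"
    and p_pos: "\<And>n. p n > 0"
    and p_le: "\<And>n. p n \<le> \<rho>" and q_ge: "\<And>n. \<rho> \<le> q n"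
    and step: "\<And>n x. h (Suc n) x = max (h n x) (max_image \<A> (h n) x / \<gamma> (p n) (q n))"
begin

abbreviation "T \<equiv> max_image \<A>"

definition "g n = \<gamma> (p n) (q n)"

lemma rho_pos: "\<rho> > 0"
  using p_pos[of 0] p_le[of 0] by linarith

lemma q_pos: "q n > 0"
  using rho_pos q_ge[of n] by linarith

lemma g_bounds: "p n \<le> g n" "g n \<le> q n" "g n > 0"
  using averaging_between[OF avg, of "p n" "q n"] p_pos[of n] p_le[of n] q_ge[of n] by (auto simp: g_def)

lemma h_step: "h (Suc n) x = max (h n x) (T (h n) x / g n)"
  by (simp add: step g_def)

lemma h_step_ge: "h n x \<le> h (Suc n) x" "T (h n) x / g n \<le> h (Suc n) x"
  by (simp_all add: h_step)

section \<open>Monotonicity of the norms and of the two bounds\<close>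

lemma h_incseq: "incseq (\<lambda>n. h n x)"
  by (simp add: incseq_SucI h_step_ge(1))

lemma h_mono: "m \<le> n \<Longrightarrow> h m x \<le> h n x"
  using h_incseq[of x] by (simp add: incseq_def)

lemma T_mono: "m \<le> n \<Longrightarrow> T (h m) x \<le> T (h n) x"
  by (intro max_image_mono fin ne h_mono)

lemma h_le_T: "A \<in> \<A> \<Longrightarrow> h n (x v* A) \<le> T (h n) x"
  by (rule max_image_ge[OF fin])

lemma T_step_le: "T (h n) x \<le> g n * h (Suc n) x"
  using h_step_ge(2)[of n x] g_bounds(3)[of n] by (simp add: pos_divide_le_eq mult.commute)

text \<open>Both entries of the maximum defining \<open>h (Suc n)\<close>, multiplied by
  \<open>p n\<close>, stay below \<open>T (h (Suc n))\<close>: the first by monotonicity of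
  \<open>T\<close>, the second by using the lower bound at the image vector that attains
  \<open>T (h n) x\<close>. A minimizer of the new ratio then compares the bounds.\<close>

lemma p_incseq: "incseq p"
proof (rule incseq_SucI)
  fix n
  obtain x where x: "x \<noteq> 0" "T (h (Suc n)) x = p (Suc n) * h (Suc n) x"
    using lower_attained by blast
  have "p n * h n x \<le> T (h (Suc n)) x"
    using lower[of n x] T_mono[of n "Suc n" x] by linarith
  moreover have "p n * (T (h n) x / g n) \<le> T (h (Suc n)) x"
  proof -
    obtain A where A: "A \<in> \<A>" "T (h n) x = h n (x v* A)"
      using max_image_attained[OF fin ne, of "h n" x] by blast
    have "p n * T (h n) x / g n \<le> T (h n) (x v* A) / g n"
      using lower[of n "x v* A"] A(2) g_bounds(3)[of n] by (simp add: divide_right_mono)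
    also have "\<dots> \<le> h (Suc n) (x v* A)" by (rule h_step_ge)
    also have "\<dots> \<le> T (h (Suc n)) x" by (rule h_le_T[OF A(1)])
    finally show ?thesis by simp
  qed
  ultimately have "p n * h (Suc n) x \<le> p (Suc n) * h (Suc n) x"
    using x(2) by (cases "h n x \<le> T (h n) x / g n") (simp_all add: h_step)
  then show "p n \<le> p (Suc n)" using pos[OF x(1)] by simp
qed

text \<open>At a maximizer \<open>x\<close> of the new ratio, \<open>T (h (Suc n)) x\<close> is the
  value of \<open>h (Suc n)\<close> at some image \<open>x v* A\<close>. Each of the two entries of
  the maximum there is at most \<open>q n * h (Suc n) x\<close>.\<close>

lemma q_decseq: "decseq q"
proof (rule decseq_SucI)
  fix n
  obtain x where x: "x \<noteq> 0" "T (h (Suc n)) x = q (Suc n) * h (Suc n) x"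
    using upper_attained by blast
  obtain A where A: "A \<in> \<A>" "T (h (Suc n)) x = h (Suc n) (x v* A)"
    using max_image_attained[OF fin ne, of "h (Suc n)" x] by blast
  have "h n (x v* A) \<le> q n * h (Suc n) x"
    using h_le_T[OF A(1), of n x] upper[of n x] h_step_ge(1)[of n x] q_pos[of n]
    by (meson less_imp_le mult_left_mono order_trans)
  moreover have "T (h n) (x v* A) / g n \<le> q n * h (Suc n) x"
  proof -
    have "T (h n) (x v* A) / g n \<le> q n * T (h n) x / g n"
      using upper[of n "x v* A"] h_le_T[OF A(1), of n x] q_pos[of n] g_bounds(3)[of n]
      by (meson divide_right_mono less_imp_le mult_left_mono order_trans)
    also have "\<dots> \<le> q n * h (Suc n) x"
      using h_step_ge(2)[of n x] q_pos[of n] by (simp flip: times_divide_eq_right)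
    finally show ?thesis .
  qed
  ultimately have "q (Suc n) * h (Suc n) x \<le> q n * h (Suc n) x"
    using x(2) A(2) h_step[of n "x v* A"] by simp
  then show "q (Suc n) \<le> q n" using pos[OF x(1)] by simp
qed

lemma q_le_q0: "q n \<le> q 0"
  using q_decseq by (simp add: decseq_def)

lemma h_image_le: "A \<in> \<A> \<Longrightarrow> h n (x v* A) \<le> q 0 * h n x"
  using h_le_T upper[of n x] mult_right_mono[OF q_le_q0 seminorm_nonneg[OF sn], of n n x]
  by (meson order_trans)

text \<open>As \<open>q\<close> decreases, \<open>q 0\<close> serves as growth constant for every
  \<open>h n\<close>, so a single \<open>C\<close> works for the whole sequence.\<close>

lemma eccentricity:
  obtains C where "C > 0" "\<And>n x y. h n y * norm x \<le> C * h n x * norm y"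
  using irreducible_eccentricity[OF irr, of "q 0"] h_image_le sn by metis

section \<open>Coincidence of the limits of the two bounds\<close>

lemma limits_coincide:
  assumes p: "p \<longlonglongrightarrow> p'" and q: "q \<longlonglongrightarrow> q'"
  shows "p' = q'"
proof (rule ccontr)
  assume "p' \<noteq> q'"
  have p_le': "p n \<le> p'" for n by (rule incseq_le[OF p_incseq p])
  have q_ge': "q' \<le> q n" for n by (rule decseq_ge[OF q_decseq q])
  have "p' \<le> \<rho>" "\<rho> \<le> q'"
    using LIMSEQ_le_const2[OF p] LIMSEQ_le_const[OF q] p_le q_ge by blast+
  with \<open>p' \<noteq> q'\<close> have "p' < q'" by simp
  have p'_pos: "p' > 0" using p_pos[of 0] p_le'[of 0] by linarith
  \<comment> \<open>Continuity of \<open>\<gamma>\<close> is known only on the open quadrant, so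
    \<open>p' > 0\<close> is essential here.\<close>
  have "isCont (\<lambda>(t, s). \<gamma> t s) (p', q')"
  proof (rule continuous_on_interior)
    show "continuous_on ({0<..} \<times> {0<..}) (\<lambda>(t, s). \<gamma> t s)"
      using avg by (simp add: averaging_function_def)
    show "(p', q') \<in> interior ({0<..} \<times> {0<..})"
      using p'_pos \<open>p' < q'\<close> by (simp add: interior_open open_Times)
  qed
  from isCont_tendsto_compose[OF this tendsto_Pair[OF p q]]
  have g: "g \<longlonglongrightarrow> \<gamma> p' q'" by (simp add: g_def[abs_def])
  have \<gamma>': "p' < \<gamma> p' q'" "\<gamma> p' q' < q'"
    using averaging_strictly_between[OF avg p'_pos \<open>p' < q'\<close>] .
  \<comment> \<open>The midpoint separates the eventual values of \<open>g\<close> from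
    \<open>q'\<close> by a fixed gap.\<close>
  define b where "b = (\<gamma> p' q' + q') / 2"
  have b: "\<gamma> p' q' < b" "b < q'" using \<gamma>' by (auto simp: b_def)
  obtain N where N: "\<And>n. n \<ge> N \<Longrightarrow> p' < g n" "\<And>n. n \<ge> N \<Longrightarrow> g n < b"
    using eventually_conj[OF order_tendstoD(1)[OF g \<gamma>'(1)] order_tendstoD(2)[OF g b(1)]]
    by (auto simp: eventually_sequentially)
  \<comment> \<open>At a minimizer of the ratio for \<^term>\<open>h n\<close>, no earlier step from \<^term>\<open>N\<close> on has increased
    the norm; by bounded eccentricity the whole sequence is therefore bounded.\<close>
  have frozen: "\<exists>x. x \<noteq> 0 \<and> h n x = h N x" if "n \<ge> N" for n
  proof -
    obtain x where x: "x \<noteq> 0" "T (h n) x = p n * h n x" using lower_attained by blast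
    \<comment> \<open>Downward induction from \<open>n\<close>: monotonicity gives
      \<open>T (h m) x \<le> p n * h n x < g m * h n x\<close>, so the maximum defining
      \<open>h (Suc m) x\<close> is its entry \<open>h m x\<close>.\<close>
    have "h m x = h n x" if "N \<le> m" "m \<le> n" for m
      using that(2,1)
    proof (induction m rule: inc_induct)
      case (step m)
      then have IH: "h (Suc m) x = h n x" by simp
      have "T (h m) x \<le> p n * h n x" using T_mono[of m n x] step.hyps x(2) by simp
      also have "\<dots> < g m * h n x"
        using p_le'[of n] N(1)[OF step.prems] pos[OF x(1), of n] by (simp add: le_less_trans)
      finally have "T (h m) x / g m < h (Suc m) x"
        using g_bounds(3)[of m] IH by (simp add: pos_divide_less_eq mult.commute)
      then show ?case using h_step[of m x] IH by (simp add: max_def split: if_splits)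
    qed simp
    from this[of N] that x(1) show ?thesis by auto
  qed
  obtain C where C: "C > 0" "\<And>n x y. h n y * norm x \<le> C * h n x * norm y"
    using eccentricity by blast
  obtain D where D: "D > 0" "\<And>x. h N x \<le> D * norm x" using seminorm_upper_bound[OF sn] by blast
  define E where "E = C * D"
  have bounded: "h n y \<le> E * norm y" for n y
  proof -
    \<comment> \<open>Indices below \<open>N\<close> are reached through \<open>max n N\<close>,
      since the norms increase with the index.\<close>
    obtain x where x: "x \<noteq> 0" "h (max n N) x = h N x" using frozen[of "max n N"] by auto
    have "h (max n N) y * norm x \<le> C * h N x * norm y" using C(2)[of "max n N" y x] x(2) by simp
    also have "\<dots> \<le> C * (D * norm x) * norm y"
      using C(1) D(2)[of x] by (intro mult_right_mono mult_left_mono) auto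
    finally have "h (max n N) y \<le> E * norm y"
      using x(1) by (simp add: E_def mult.assoc mult.left_commute[of _ "norm x"] mult.commute[of _ "norm x"])
    then show ?thesis using h_mono[of n "max n N" y] by simp
  qed
  \<comment> \<open>At a maximizer of the ratio, each step increases the norm by a factor bounded away from 1,
    which is impossible for a bounded increasing sequence.\<close>
  have "\<exists>y. norm y = 1 \<and> q n * h n y \<le> g n * h (Suc n) y" for n
  proof -
    obtain y where y: "y \<noteq> 0" "T (h n) y = q n * h n y" using upper_attained by blast
    show ?thesis
    proof (intro exI conjI)
      show "norm (y /\<^sub>R norm y) = 1" using y(1) by simp
      show "q n * h n (y /\<^sub>R norm y) \<le> g n * h (Suc n) (y /\<^sub>R norm y)"
        using T_step_le[of n y] y by (simp add: seminorm_scaleR[OF sn] divide_right_mono mult.left_commute mult_left_mono)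
    qed
  qed
  then obtain y where y: "\<And>n. norm (y n) = 1" "\<And>n. q n * h n (y n) \<le> g n * h (Suc n) (y n)"
    by metis
  \<comment> \<open>The maximizers vary with \<open>n\<close>; a limit direction \<open>z\<close>
    allows the growth to be tested at one fixed vector.\<close>
  obtain z r where z: "z \<in> sphere 0 1" "strict_mono r" "(y \<circ> r) \<longlonglongrightarrow> z"
    using compact_sphere[of "0::real^'d" 1, unfolded compact_def, rule_format, of y] y(1) by auto
  have z_nz: "z \<noteq> 0" using z(1) by auto
  obtain l where l: "(\<lambda>n. h n z) \<longlonglongrightarrow> l" "\<And>n. h n z \<le> l"
    using incseq_convergent[OF h_incseq, of z "E * norm z"] bounded by blast
  have move: "\<bar>h m u - h m z\<bar> \<le> E * norm (u - z)" for m u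
    using order_trans[OF seminorm_abs_diff[OF sn] bounded] .
  have E_pos: "E > 0" using C D by (simp add: E_def)
  \<comment> \<open>The growth inequality at \<open>y (r n)\<close> is moved to \<open>z\<close> at
    the cost of the Lipschitz error \<open>E * norm (y (r n) - z)\<close>.\<close>
  have ineq: "q' * (h (r n) z - E * norm (y (r n) - z)) \<le> b * (h (Suc (r n)) z + E * norm (y (r n) - z))"
    if "n \<ge> N" for n
  proof -
    have rn: "r n \<ge> N" using that seq_suble[OF z(2), of n] by simp
    have "q' * (h (r n) z - E * norm (y (r n) - z)) \<le> q' * h (r n) (y (r n))"
      using move[of "r n" "y (r n)"] p'_pos \<open>p' < q'\<close> by (intro mult_left_mono) auto
    also have "\<dots> \<le> q (r n) * h (r n) (y (r n))"
      using q_ge' seminorm_nonneg[OF sn] by (intro mult_right_mono) auto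
    also have "\<dots> \<le> g (r n) * h (Suc (r n)) (y (r n))" by (rule y)
    also have "\<dots> \<le> b * h (Suc (r n)) (y (r n))"
      using N(2)[OF rn] seminorm_nonneg[OF sn] by (intro mult_right_mono) auto
    also have "\<dots> \<le> b * (h (Suc (r n)) z + E * norm (y (r n) - z))"
      using move[of "Suc (r n)" "y (r n)"] b p'_pos \<gamma>' by (intro mult_left_mono) auto
    finally show ?thesis .
  qed
  have d0: "(\<lambda>n. norm (y (r n) - z)) \<longlonglongrightarrow> 0"
    using z(3) by (simp add: tendsto_norm_zero_iff LIM_zero_iff o_def)
  have l1: "(\<lambda>n. h (r n) z) \<longlonglongrightarrow> l"
    using LIMSEQ_subseq_LIMSEQ[OF l(1) z(2)] by (simp add: o_def)
  have "strict_mono (\<lambda>n. Suc (r n))" using z(2) by (simp add: strict_mono_def)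
  from LIMSEQ_subseq_LIMSEQ[OF l(1) this]
  have l2: "(\<lambda>n. h (Suc (r n)) z) \<longlonglongrightarrow> l" by (simp add: o_def)
  \<comment> \<open>Both sides involve the same limit \<open>l\<close> of the increasing values at
    \<open>z\<close>, so \<open>q' * l \<le> b * l\<close> with \<open>l > 0\<close>, against
    \<open>b < q'\<close>.\<close>
  have "q' * (l - E * 0) \<le> b * (l + E * 0)"
  proof (rule LIMSEQ_le)
    show "(\<lambda>n. q' * (h (r n) z - E * norm (y (r n) - z))) \<longlonglongrightarrow> q' * (l - E * 0)"
      by (intro tendsto_intros l1 d0)
    show "(\<lambda>n. b * (h (Suc (r n)) z + E * norm (y (r n) - z))) \<longlonglongrightarrow> b * (l + E * 0)"
      by (intro tendsto_intros l2 d0)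
  qed (use ineq in blast)
  then have "q' * l \<le> b * l" by simp
  moreover have "l > 0" using l(2)[of 0] pos[OF z_nz, of 0] by linarith
  ultimately show False using b by simp
qed

section \<open>Convergence of the bounds and of the normalized norms\<close>

lemma p_tendsto: "p \<longlonglongrightarrow> \<rho>" and q_tendsto: "q \<longlonglongrightarrow> \<rho>"
proof -
  obtain p' where p': "p \<longlonglongrightarrow> p'" using incseq_convergent[OF p_incseq, of \<rho>] p_le by blast
  obtain q' where q': "q \<longlonglongrightarrow> q'" using decseq_convergent[OF q_decseq, of \<rho>] q_ge by blast
  have "p' \<le> \<rho>" "\<rho> \<le> q'"
    using LIMSEQ_le_const2[OF p'] LIMSEQ_le_const[OF q'] p_le q_ge by blast+
  with limits_coincide[OF p' q'] p' q' show "p \<longlonglongrightarrow> \<rho>" "q \<longlonglongrightarrow> \<rho>" by auto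
qed

text \<open>Bounded eccentricity makes the norms, divided by their value at a fixed unit vector,
  uniformly bounded, so a subsequence converges. The ratio bounds both tend to \<open>\<rho>\<close>
  and force the eigenvalue equation; irreducibility gives positivity of the limit.\<close>

lemma limit_norm:
  obtains f r s where "seminorm_on_space f" "\<And>x. x \<noteq> 0 \<Longrightarrow> f x > 0" "\<And>x. T f x = \<rho> * f x"
    "strict_mono (r :: nat \<Rightarrow> nat)" "\<And>n. s n > 0" "\<And>x. (\<lambda>n. h (r n) x / s n) \<longlonglongrightarrow> f x"
    "\<And>e. e > 0 \<Longrightarrow> \<forall>\<^sub>F n in sequentially. \<forall>x. \<bar>h (r n) x / s n - f x\<bar> \<le> e * norm x"
proof -
  obtain C where C: "C > 0" "\<And>n x y. h n y * norm x \<le> C * h n x * norm y"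
    using eccentricity by blast
  obtain u :: "real^'d" where u: "norm u = 1" using vector_choose_size[of 1] by auto
  have hu: "h n u > 0" for n using u by (intro pos) auto
  obtain f r where f: "seminorm_on_space f" and r: "strict_mono (r :: nat \<Rightarrow> nat)"
    and lim: "\<And>x. (\<lambda>n. h (r n) x / h (r n) u) \<longlonglongrightarrow> f x"
    and unif: "\<And>e. e > 0 \<Longrightarrow> \<forall>\<^sub>F n in sequentially. \<forall>x. \<bar>h (r n) x / h (r n) u - f x\<bar> \<le> e * norm x"
  proof (rule seminorm_compactness[of "\<lambda>n x. h n x / h n u" C])
    show "seminorm_on_space (\<lambda>x. h n x / h n u)" for n
      using hu[of n] by (intro seminorm_divide sn) simp
    show "h n x / h n u \<le> C * norm x" for n x
      using C(2)[of n x u] hu[of n] u by (simp add: pos_divide_le_eq mult.commute mult.left_commute)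
  qed (rule that)
  have fu: "f u = 1" using lim[of u] hu by (simp add: LIMSEQ_const_iff less_imp_neq[THEN not_sym])
  have qr: "(\<lambda>n. q (r n)) \<longlonglongrightarrow> \<rho>" and pr: "(\<lambda>n. p (r n)) \<longlonglongrightarrow> \<rho>"
    using LIMSEQ_subseq_LIMSEQ[OF q_tendsto r] LIMSEQ_subseq_LIMSEQ[OF p_tendsto r]
    by (simp_all add: o_def)
  have up: "f (x v* A) \<le> \<rho> * f x" if "A \<in> \<A>" for A x
  proof (rule LIMSEQ_le[OF lim tendsto_mult[OF qr lim]])
    have "h m (x v* A) / h m u \<le> q m * (h m x / h m u)" for m
      using order_trans[OF h_le_T[OF that] upper, of m x] hu[of m] by (simp add: divide_right_mono)
    then show "\<exists>N. \<forall>n\<ge>N. h (r n) (x v* A) / h (r n) u \<le> q (r n) * (h (r n) x / h (r n) u)"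
      by blast
  qed
  have fpos: "f x > 0" if "x \<noteq> 0" for x
    using irreducible_seminorm_pos[OF irr f up _ that, of u] fu by simp
  have "\<rho> * f x \<le> T f x" for x
  proof (rule field_le_epsilon)
    fix e :: real assume e: "e > 0"
    \<comment> \<open>The matrix attaining the maximum depends on \<open>n\<close>, so closeness is
      required for all of the finitely many matrices at once.\<close>
    have "\<forall>\<^sub>F n in sequentially. \<forall>A\<in>\<A>. h (r n) (x v* A) / h (r n) u < f (x v* A) + e"
      using e by (intro eventually_ball_finite fin ballI order_tendstoD(2)[OF lim]) simp
    then have "\<forall>\<^sub>F n in sequentially. p (r n) * (h (r n) x / h (r n) u) \<le> T f x + e"
    proof eventually_elim
      case (elim n)
      obtain A where A: "A \<in> \<A>" "T (h (r n)) x = h (r n) (x v* A)"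
        using max_image_attained[OF fin ne, of "h (r n)" x] by blast
      have "p (r n) * (h (r n) x / h (r n) u) \<le> h (r n) (x v* A) / h (r n) u"
        using lower[of "r n" x] A(2) hu[of "r n"] by (simp add: divide_right_mono)
      also have "\<dots> \<le> f (x v* A) + e" using elim A(1) by fastforce
      also have "\<dots> \<le> T f x + e" using max_image_ge[OF fin A(1), of f x] by simp
      finally show ?case .
    qed
    then show "\<rho> * f x \<le> T f x + e"
      by (intro tendsto_upperbound[OF tendsto_mult[OF pr lim]]) auto
  qed
  moreover have "T f x \<le> \<rho> * f x" for x
    using max_image_attained[OF fin ne, of f x] up by metis
  ultimately have "T f x = \<rho> * f x" for x by (simp add: order_antisym)
  then show thesis
    using that[of f r "\<lambda>n. h (r n) u"] f fpos r hu lim unif by blast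
qed

text \<open>On an eigenfunction of \<^term>\<open>max_image \<A>\<close> a relaxation step is multiplication by a scalar, and
  the step is monotone, so the projective distance to the eigenfunction does not grow.\<close>

lemma sandwich:
  assumes f: "seminorm_on_space f" and Tf: "\<And>x. T f x = \<rho> * f x"
    and ab: "0 < a" "0 < b" and c: "c > 0"
    and N: "\<And>x. a * c * f x \<le> h N x" "\<And>x. h N x \<le> b * c * f x" and "n \<ge> N"
  shows "\<exists>c>0. \<forall>x. a * c * f x \<le> h n x \<and> h n x \<le> b * c * f x"
  using \<open>n \<ge> N\<close>
proof (induction n rule: dec_induct)
  case base
  then show ?case using c N by blast
next
  case (step n)
  then obtain c where c: "c > 0" "\<And>x. a * c * f x \<le> h n x" "\<And>x. h n x \<le> b * c * f x" by blast
  \<comment> \<open>A relaxation step with parameter \<open>g n\<close> multiplies every positive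
    multiple of \<open>f\<close> by \<open>max 1 (\<rho> / g n)\<close>.\<close>
  define c' where "c' = c * max 1 (\<rho> / g n)"
  have scale: "max (s * f x) (s * (\<rho> * f x) / g n) = s * max 1 (\<rho> / g n) * f x" if "s > 0" for s x
  proof (cases "\<rho> \<le> g n")
    case True
    then have "s * f x * (\<rho> / g n) \<le> s * f x * 1"
      using that seminorm_nonneg[OF f, of x] g_bounds(3)[of n] by (intro mult_left_mono) auto
    then show ?thesis using True g_bounds(3)[of n] by (simp add: max_def mult_ac)
  next
    case False
    then have "s * f x * 1 \<le> s * f x * (\<rho> / g n)"
      using that seminorm_nonneg[OF f, of x] g_bounds(3)[of n] by (intro mult_left_mono) auto
    then show ?thesis using False g_bounds(3)[of n] by (auto simp: max_def mult_ac)
  qed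
  have T_scale: "T (\<lambda>x. s * f x) x = s * (\<rho> * f x)" if "s > 0" for s x
    using max_image_scale[OF fin ne, of s f x] that Tf by simp
  have "a * c' * f x \<le> h (Suc n) x" for x
  proof -
    have "a * c' * f x = max (a * c * f x) (T (\<lambda>x. a * c * f x) x / g n)"
      using scale[of "a * c" x] T_scale[of "a * c" x] ab c(1) by (simp add: c'_def mult_ac)
    also have "\<dots> \<le> h (Suc n) x"
      unfolding h_step using g_bounds(3)[of n]
      by (intro max.mono c divide_right_mono max_image_mono fin ne) auto
    finally show ?thesis .
  qed
  moreover have "h (Suc n) x \<le> b * c' * f x" for x
  proof -
    have "h (Suc n) x \<le> max (b * c * f x) (T (\<lambda>x. b * c * f x) x / g n)"
      unfolding h_step using g_bounds(3)[of n]
      by (intro max.mono c divide_right_mono max_image_mono fin ne) auto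
    also have "\<dots> = b * c' * f x"
      using scale[of "b * c" x] T_scale[of "b * c" x] ab c(1) by (simp add: c'_def mult_ac)
    finally show ?thesis .
  qed
  moreover have "c' > 0" using c(1) by (simp add: c'_def)
  ultimately show ?case by blast
qed

text \<open>One index with small relative distance to a multiple of \<open>f\<close> suffices, since
  \<open>sandwich\<close> propagates it to all later ones. The scalar \<open>c\<close> may change
  with \<open>n\<close>, but the factors \<open>1 - e\<close> and \<open>1 + e\<close> do
  not.\<close>

lemma eventual_sandwich:
  obtains f r s where "seminorm_on_space f" "\<And>x. x \<noteq> 0 \<Longrightarrow> f x > 0" "\<And>x. T f x = \<rho> * f x"
    "\<And>n. s n > 0" "\<And>x. (\<lambda>n. h (r n) x / s n) \<longlonglongrightarrow> f x"
    "\<And>e. 0 < e \<Longrightarrow> e < 1 \<Longrightarrow> \<exists>N. \<forall>n\<ge>N. \<exists>c>0. \<forall>x.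
        (1 - e) * c * f x \<le> h n x \<and> h n x \<le> (1 + e) * c * f x"
proof -
  obtain f r s where f: "seminorm_on_space f" and fpos: "\<And>x. x \<noteq> 0 \<Longrightarrow> f x > 0"
    and Tf: "\<And>x. T f x = \<rho> * f x" and s: "\<And>n. s n > 0"
    and lim: "\<And>x. (\<lambda>n. h (r n) x / s n) \<longlonglongrightarrow> f x"
    and unif: "\<And>e. e > 0 \<Longrightarrow> \<forall>\<^sub>F n in sequentially. \<forall>x. \<bar>h (r n) x / s n - f x\<bar> \<le> e * norm x"
    by (rule limit_norm) (rule that)
  obtain c where c: "c > 0" "\<And>x. c * norm x \<le> f x" using seminorm_lower_bound[OF f fpos] by blast
  have "\<exists>N. \<forall>n\<ge>N. \<exists>c>0. \<forall>x. (1 - e) * c * f x \<le> h n x \<and> h n x \<le> (1 + e) * c * f x"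
    if e: "0 < e" "e < 1" for e
  proof -
    \<comment> \<open>With the error \<open>e * c * norm x\<close> and
      \<open>c * norm x \<le> f x\<close>, closeness becomes relative to \<open>f\<close>.\<close>
    have "e * c > 0" using e c by simp
    from eventually_happens'[OF trivial_limit_sequentially unif[OF this]]
    obtain n where n: "\<And>x. \<bar>h (r n) x / s n - f x\<bar> \<le> e * c * norm x" by blast
    have close: "\<bar>h (r n) x / s n - f x\<bar> \<le> e * f x" for x
      using order_trans[OF n[of x], of "e * f x"] mult_left_mono[OF c(2)[of x], of e] e
      by (simp add: mult.assoc)
    have N: "(1 - e) * s n * f x \<le> h (r n) x" "h (r n) x \<le> (1 + e) * s n * f x" for x
    proof -
      have "(1 - e) * f x \<le> h (r n) x / s n" "h (r n) x / s n \<le> (1 + e) * f x"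
        using close[of x] by (auto simp: algebra_simps abs_le_iff)
      then show "(1 - e) * s n * f x \<le> h (r n) x" "h (r n) x \<le> (1 + e) * s n * f x"
        using s[of n] by (simp_all add: pos_le_divide_eq pos_divide_le_eq mult_ac)
    qed
    have "0 < 1 - e" "0 < 1 + e" using e by auto
    from sandwich[OF f Tf this s[of n] N] show ?thesis by blast
  qed
  from that[OF f fpos Tf s lim this] show thesis .
qed

end

section \<open>Support functions\<close>

text \<open>The supremum has its intended value only over nonempty sets bounded in direction
  \<open>x\<close>.\<close>

definition support_function :: "'a::euclidean_space set \<Rightarrow> 'a \<Rightarrow> real" where
  "support_function M x = (SUP y\<in>M. y \<bullet> x)"

lemma support_function_upper:
  assumes "bounded M" "y \<in> M" shows "y \<bullet> x \<le> support_function M x"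
  unfolding support_function_def
proof (rule cSUP_upper)
  obtain B where "\<And>y. y \<in> M \<Longrightarrow> norm y \<le> B" using assms(1) by (auto simp: bounded_iff)
  then have "y \<bullet> x \<le> B * norm x" if "y \<in> M" for y
    using that norm_cauchy_schwarz[of y x] mult_right_mono[of "norm y" B "norm x"] by fastforce
  then show "bdd_above ((\<lambda>y. y \<bullet> x) ` M)" by (intro bdd_aboveI2)
qed (rule assms)

lemma support_function_least:
  "M \<noteq> {} \<Longrightarrow> (\<And>y. y \<in> M \<Longrightarrow> y \<bullet> x \<le> c) \<Longrightarrow> support_function M x \<le> c"
  unfolding support_function_def by (rule cSUP_least)

lemma support_function_attained:
  assumes "compact M" "M \<noteq> {}"
  obtains y where "y \<in> M" "y \<bullet> x = support_function M x"
proof -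
  have "continuous_on M (\<lambda>y. y \<bullet> x)" by (intro continuous_intros)
  from continuous_attains_sup[OF assms this]
  obtain y where y: "y \<in> M" "\<And>z. z \<in> M \<Longrightarrow> z \<bullet> x \<le> y \<bullet> x" by blast
  then have "y \<bullet> x = support_function M x"
    using support_function_upper[OF compact_imp_bounded[OF assms(1)] y(1)]
      support_function_least[OF assms(2) y(2)] by (simp add: order_antisym)
  with y(1) show thesis by (rule that)
qed

lemma support_function_mono:
  "bounded N \<Longrightarrow> M \<noteq> {} \<Longrightarrow> M \<subseteq> N \<Longrightarrow> support_function M x \<le> support_function N x"
  by (intro support_function_least support_function_upper) auto

text \<open>A half-space that contains \<open>S\<close> also contains its convex hull.\<close>

lemma support_function_convex_hull:
  assumes "bounded S" "S \<noteq> {}"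
  shows "support_function (convex hull S) x = support_function S x"
proof (rule antisym)
  have "convex {y. y \<bullet> x \<le> support_function S x}"
    using convex_halfspace_le[of x] by (simp add: inner_commute)
  then have "convex hull S \<subseteq> {y. y \<bullet> x \<le> support_function S x}"
    by (intro hull_minimal) (auto intro: support_function_upper assms)
  then show "support_function (convex hull S) x \<le> support_function S x"
    using assms(2) by (intro support_function_least) auto
  show "support_function S x \<le> support_function (convex hull S) x"
    using assms by (intro support_function_mono bounded_convex_hull hull_subset)
qed

lemma support_function_Un:
  assumes "bounded S" "S \<noteq> {}" "bounded T" "T \<noteq> {}"
  shows "support_function (S \<union> T) x = max (support_function S x) (support_function T x)"
proof (rule antisym)
  have "bounded (S \<union> T)" using assms by simp
  then show "max (support_function S x) (support_function T x) \<le> support_function (S \<union> T) x"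
    using assms by (intro max.boundedI support_function_mono) auto
  show "support_function (S \<union> T) x \<le> max (support_function S x) (support_function T x)"
    using assms by (intro support_function_least) (auto simp: le_max_iff_disj support_function_upper)
qed

lemma support_function_scaleR:
  assumes "compact M" "M \<noteq> {}" "c \<ge> 0"
  shows "support_function ((*\<^sub>R) c ` M) x = c * support_function M x"
proof (rule antisym)
  have bd: "bounded M" using assms(1) by (rule compact_imp_bounded)
  show "support_function ((*\<^sub>R) c ` M) x \<le> c * support_function M x"
    using assms by (intro support_function_least)
      (auto intro!: mult_left_mono support_function_upper[OF bd])
  obtain y where y: "y \<in> M" "y \<bullet> x = support_function M x"
    using support_function_attained[OF assms(1,2)] by blast
  have "(c *\<^sub>R y) \<bullet> x \<le> support_function ((*\<^sub>R) c ` M) x"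
    using y(1) by (intro support_function_upper bounded_scaling bd) auto
  then show "c * support_function M x \<le> support_function ((*\<^sub>R) c ` M) x"
    using y(2) by simp
qed

text \<open>A point outside the closed convex set \<open>N\<close> is strictly separated from it by
  a hyperplane, whose normal is a direction violating the inequality.\<close>

lemma subset_iff_support_function:
  assumes "bounded M" "M \<noteq> {}" "compact N" "convex N" "N \<noteq> {}"
  shows "M \<subseteq> N \<longleftrightarrow> (\<forall>x. support_function M x \<le> support_function N x)"
proof
  assume "M \<subseteq> N"
  then show "\<forall>x. support_function M x \<le> support_function N x"
    using assms by (auto intro: support_function_mono compact_imp_bounded)
next
  assume le: "\<forall>x. support_function M x \<le> support_function N x"
  show "M \<subseteq> N"
  proof (rule ccontr)
    assume "\<not> M \<subseteq> N"
    then obtain z where z: "z \<in> M" "z \<notin> N" by blast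
    obtain a b where ab: "a \<bullet> z < b" "\<And>x. x \<in> N \<Longrightarrow> a \<bullet> x > b"
      using separating_hyperplane_closed_point[OF assms(4) compact_imp_closed[OF assms(3)] z(2)]
      by blast
    \<comment> \<open>The separation bounds \<open>N\<close> from below along \<open>a\<close>,
      hence its support function from above at \<open>- a\<close>.\<close>
    have "support_function N (- a) \<le> - b"
      using ab(2) assms(5) by (intro support_function_least) (auto simp: inner_commute less_imp_le)
    moreover have "z \<bullet> (- a) \<le> support_function M (- a)"
      by (rule support_function_upper[OF assms(1) z(1)])
    ultimately show False using le[rule_format, of "- a"] ab(1) by (simp add: inner_commute)
  qed
qed

lemma support_function_matrix:
  fixes A :: "real^'d^'d"
  shows "support_function ((*v) A ` M) x = support_function M (x v* A)"
  by (simp add: support_function_def image_image dot_lmul_matrix inner_commute[of _ x]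
      inner_commute[of _ "x v* A"])

section \<open>Support functions of unions of images and of symmetric convex bodies\<close>

lemma compact_union_image: "finite \<A> \<Longrightarrow> compact M \<Longrightarrow> compact (union_image \<A> M)"
  unfolding union_image_def
  by (intro compact_UN compact_continuous_image matrix_vector_mult_linear_continuous_on)

lemma union_image_nonempty: "\<A> \<noteq> {} \<Longrightarrow> M \<noteq> {} \<Longrightarrow> union_image \<A> M \<noteq> {}"
  by (auto simp: union_image_def)

lemma support_function_union_image:
  assumes "finite \<A>" "\<A> \<noteq> {}" "compact M" "M \<noteq> {}"
  shows "support_function (union_image \<A> M) x = max_image \<A> (support_function M) x"
proof (rule antisym)
  show "support_function (union_image \<A> M) x \<le> max_image \<A> (support_function M) x"
  proof (rule support_function_least)
    fix y assume "y \<in> union_image \<A> M"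
    then obtain A m where A: "A \<in> \<A>" "m \<in> M" "y = A *v m" by (auto simp: union_image_def)
    have "y \<bullet> x = m \<bullet> (x v* A)" by (metis A(3) dot_lmul_matrix inner_commute)
    also have "\<dots> \<le> support_function M (x v* A)"
      by (intro support_function_upper compact_imp_bounded assms A)
    also have "\<dots> \<le> max_image \<A> (support_function M) x" by (rule max_image_ge[OF assms(1) A(1)])
    finally show "y \<bullet> x \<le> max_image \<A> (support_function M) x" .
  qed (intro union_image_nonempty assms)
  obtain A where A: "A \<in> \<A>" "max_image \<A> (support_function M) x = support_function M (x v* A)"
    using max_image_attained[OF assms(1,2)] by blast
  have "support_function ((*v) A ` M) x \<le> support_function (union_image \<A> M) x"
    using A(1) assms
    by (intro support_function_mono compact_imp_bounded compact_union_image)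
      (auto simp: union_image_def)
  then show "max_image \<A> (support_function M) x \<le> support_function (union_image \<A> M) x"
    by (simp add: A(2) support_function_matrix)
qed

text \<open>The interior is convex and symmetric, so it contains the midpoint of \<open>x\<close>
  and \<open>- x\<close>.\<close>

lemma symmetric_convex_body_0:
  assumes "convex_body M" "centrally_symmetric M"
  shows "0 \<in> interior M"
proof -
  obtain x where x: "x \<in> interior M" using assms(1) by (auto simp: convex_body_def)
  have "interior M = uminus ` interior M"
    using assms(2) interior_negations[of M] by (simp add: centrally_symmetric_def)
  then have "- x \<in> interior M" using x by blast
  moreover have "convex (interior M)" using assms(1) by (simp add: convex_body_def convex_interior)
  ultimately have "(1/2) *\<^sub>R x + (1/2) *\<^sub>R (- x) \<in> interior M"
    using x by (intro convexD) auto
  then show ?thesis by simp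
qed

lemma convex_body_nonempty: "convex_body M \<Longrightarrow> M \<noteq> {}"
  by (auto simp: convex_body_def)

lemma seminorm_support_function:
  assumes M: "convex_body M" "centrally_symmetric M"
  shows "seminorm_on_space (support_function M)"
  unfolding seminorm_on_space_def
proof (intro conjI allI)
  have bd: "bounded M" using M(1) by (auto simp: convex_body_def compact_imp_bounded)
  have ne: "M \<noteq> {}" by (rule convex_body_nonempty[OF M(1)])
  show "support_function M (x + y) \<le> support_function M x + support_function M y" for x y
    by (intro support_function_least ne) (simp add: inner_add_right add_mono support_function_upper[OF bd])
  \<comment> \<open>The reverse inequality for \<open>c \<noteq> 0\<close> follows by applying this
    one to \<open>inverse c\<close> and \<open>c *\<^sub>R x\<close>.\<close>
  have le: "support_function M (c *\<^sub>R x) \<le> \<bar>c\<bar> * support_function M x" for c x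
  proof (rule support_function_least[OF ne])
    fix y assume y: "y \<in> M"
    have "- y \<in> M" using M(2) y by (auto simp: centrally_symmetric_def)
    then have "sgn c *\<^sub>R y \<bullet> x \<le> support_function M x" if "c \<noteq> 0"
      using that y support_function_upper[OF bd, of "sgn c *\<^sub>R y" x] by (auto simp: sgn_if split: if_splits)
    then have "\<bar>c\<bar> * (sgn c *\<^sub>R y \<bullet> x) \<le> \<bar>c\<bar> * support_function M x"
      by (cases "c = 0") (auto intro: mult_left_mono)
    moreover have "\<bar>c\<bar> * (sgn c *\<^sub>R y \<bullet> x) = y \<bullet> (c *\<^sub>R x)"
      by (simp add: abs_mult_sgn flip: mult.assoc)
    ultimately show "y \<bullet> c *\<^sub>R x \<le> \<bar>c\<bar> * support_function M x" by (simp only:)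
  qed
  show "support_function M (c *\<^sub>R x) = \<bar>c\<bar> * support_function M x" for c x
  proof (cases "c = 0")
    case True
    obtain y where y: "y \<in> M" using ne by blast
    have "support_function M 0 = 0"
      using support_function_upper[OF bd y, of 0] le[of 0 0] by simp
    then show ?thesis using True by simp
  next
    case False
    then show ?thesis using le[of c x] le[of "inverse c" "c *\<^sub>R x"]
      by (simp add: abs_inverse pos_le_divide_eq field_simps)
  qed
qed

text \<open>A ball of radius \<open>r\<close> about 0 inside \<open>M\<close> forces the value to be
  at least \<open>r * norm x\<close>.\<close>

lemma support_function_pos:
  assumes M: "convex_body M" "centrally_symmetric M" and "x \<noteq> 0"
  shows "support_function M x > 0"
proof -
  obtain r where r: "r > 0" "cball 0 r \<subseteq> M"
    using symmetric_convex_body_0[OF M] by (auto simp: mem_interior_cball)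
  have "(r / norm x) *\<^sub>R x \<in> M" using r assms(3) by (intro subsetD[OF r(2)]) auto
  from support_function_upper[OF _ this, of x]
  have "r * norm x \<le> support_function M x"
    using M(1) assms(3) by (simp add: convex_body_def compact_imp_bounded dot_square_norm power2_eq_square)
  moreover have "r * norm x > 0" using r assms(3) by simp
  ultimately show ?thesis by linarith
qed

lemma image_subset_scaleR_iff:
  assumes \<A>: "finite \<A>" "\<A> \<noteq> {}" and M: "convex_body M" and r: "0 \<le> r"
  shows "convex hull (union_image \<A> M) \<subseteq> (*\<^sub>R) r ` M \<longleftrightarrow>
      (\<forall>x. max_image \<A> (support_function M) x \<le> r * support_function M x)" (is ?up)
    and "(*\<^sub>R) r ` M \<subseteq> convex hull (union_image \<A> M) \<longleftrightarrow>
      (\<forall>x. r * support_function M x \<le> max_image \<A> (support_function M) x)" (is ?low)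
proof -
  have cM: "compact M" "convex M" "M \<noteq> {}"
    using M convex_body_nonempty[OF M] by (auto simp: convex_body_def)
  have cU: "compact (union_image \<A> M)" "union_image \<A> M \<noteq> {}"
    using compact_union_image union_image_nonempty \<A> cM by blast+
  have hull: "compact (convex hull (union_image \<A> M))" using cU by (intro compact_convex_hull)
  have scale: "compact ((*\<^sub>R) r ` M)" "convex ((*\<^sub>R) r ` M)"
    using cM by (auto intro: compact_scaling convex_scaling)
  have eq: "support_function (convex hull (union_image \<A> M)) x = max_image \<A> (support_function M) x" for x
    using support_function_convex_hull[OF compact_imp_bounded[OF cU(1)] cU(2)]
      support_function_union_image[OF \<A> cM(1,3)] by simp
  have eqr: "support_function ((*\<^sub>R) r ` M) x = r * support_function M x" for x
    by (rule support_function_scaleR[OF cM(1,3) r])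
  show ?up
    using subset_iff_support_function[OF compact_imp_bounded[OF hull] _ scale] cU(2) cM(3)
    by (simp add: eq eqr)
  show ?low
    using subset_iff_support_function[OF compact_imp_bounded[OF scale(1)] _ hull convex_convex_hull] cU(2) cM(3)
    by (simp add: eq eqr)
qed

text \<open>The maximal ratio is an admissible scaling factor, and the vector attaining it shows
  that no smaller factor is admissible; so the \<open>LEAST\<close> exists and equals that
  ratio.\<close>

lemma rho_plus_characterization:
  assumes \<A>: "finite \<A>" "\<A> \<noteq> {}" and M: "convex_body M" "centrally_symmetric M"
  shows "0 \<le> rho_plus \<A> M"
    and "max_image \<A> (support_function M) y \<le> rho_plus \<A> M * support_function M y"
    and "\<exists>x. x \<noteq> 0 \<and> max_image \<A> (support_function M) x = rho_plus \<A> M * support_function M x"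
proof -
  have sn: "seminorm_on_space (support_function M)" by (rule seminorm_support_function[OF M])
  obtain q x where q: "q \<ge> 0" "\<And>x. max_image \<A> (support_function M) x \<le> q * support_function M x"
    "x \<noteq> 0" "max_image \<A> (support_function M) x = q * support_function M x"
    using seminorm_ratio_max[OF sn support_function_pos[OF M] seminorm_max_image[OF \<A> sn]] by blast
  have "rho_plus \<A> M = q"
    unfolding rho_plus_def
  proof (rule Least_equality)
    show "0 \<le> q \<and> convex hull (union_image \<A> M) \<subseteq> (*\<^sub>R) q ` M"
      using q image_subset_scaleR_iff(1)[OF \<A> M(1) q(1)] by simp
    fix r assume r: "0 \<le> r \<and> convex hull (union_image \<A> M) \<subseteq> (*\<^sub>R) r ` M"
    then have "q * support_function M x \<le> r * support_function M x"
      using image_subset_scaleR_iff(1)[OF \<A> M(1), of r] q(4) by metis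
    then show "q \<le> r" using support_function_pos[OF M q(3)] by simp
  qed
  with q show "0 \<le> rho_plus \<A> M"
    "max_image \<A> (support_function M) y \<le> rho_plus \<A> M * support_function M y"
    "\<exists>x. x \<noteq> 0 \<and> max_image \<A> (support_function M) x = rho_plus \<A> M * support_function M x"
    by auto
qed

lemma rho_minus_characterization:
  assumes \<A>: "finite \<A>" "\<A> \<noteq> {}" and M: "convex_body M" "centrally_symmetric M"
  shows "0 \<le> rho_minus \<A> M"
    and "rho_minus \<A> M * support_function M y \<le> max_image \<A> (support_function M) y"
    and "\<exists>x. x \<noteq> 0 \<and> max_image \<A> (support_function M) x = rho_minus \<A> M * support_function M x"
proof -
  have sn: "seminorm_on_space (support_function M)" by (rule seminorm_support_function[OF M])
  obtain p x where p: "p \<ge> 0" "\<And>x. p * support_function M x \<le> max_image \<A> (support_function M) x"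
    "x \<noteq> 0" "max_image \<A> (support_function M) x = p * support_function M x"
    using seminorm_ratio_min[OF sn support_function_pos[OF M] seminorm_max_image[OF \<A> sn]] by blast
  have "rho_minus \<A> M = p"
    unfolding rho_minus_def
  proof (rule Greatest_equality)
    show "0 \<le> p \<and> (*\<^sub>R) p ` M \<subseteq> convex hull (union_image \<A> M)"
      using p image_subset_scaleR_iff(2)[OF \<A> M(1) p(1)] by simp
    fix r assume r: "0 \<le> r \<and> (*\<^sub>R) r ` M \<subseteq> convex hull (union_image \<A> M)"
    then have "r * support_function M x \<le> p * support_function M x"
      using image_subset_scaleR_iff(2)[OF \<A> M(1), of r] p(4) by metis
    then show "r \<le> p" using support_function_pos[OF M p(3)] by simp
  qed
  with p show "0 \<le> rho_minus \<A> M"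
    "rho_minus \<A> M * support_function M y \<le> max_image \<A> (support_function M) y"
    "\<exists>x. x \<noteq> 0 \<and> max_image \<A> (support_function M) x = rho_minus \<A> M * support_function M x"
    by auto
qed

lemma linear_image_symmetric:
  assumes "linear f" "centrally_symmetric M" shows "centrally_symmetric (f ` M)"
proof -
  have "uminus ` f ` M = f ` uminus ` M"
    by (simp add: image_image linear_neg[OF assms(1)])
  then show ?thesis using assms(2) by (simp add: centrally_symmetric_def)
qed

text \<open>The interior is inherited from \<open>M\<close>, and symmetry passes through linear
  images, unions and convex hulls.\<close>

lemma relaxation_step_body:
  assumes \<A>: "finite \<A>" and M: "convex_body M" "centrally_symmetric M"
  shows "convex_body (convex hull (M \<union> (*\<^sub>R) c ` union_image \<A> M))" (is "convex_body ?N")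
    and "centrally_symmetric (convex hull (M \<union> (*\<^sub>R) c ` union_image \<A> M))"
proof -
  have "compact (M \<union> (*\<^sub>R) c ` union_image \<A> M)"
    using M(1) \<A> by (intro compact_Un compact_scaling compact_union_image) (auto simp: convex_body_def)
  moreover have "interior M \<subseteq> interior ?N"
    by (intro interior_mono) (meson hull_subset le_sup_iff)
  ultimately show "convex_body ?N"
    using M(1) by (auto simp: convex_body_def compact_convex_hull)
  have "uminus ` union_image \<A> M = (\<Union>A\<in>\<A>. uminus ` (*v) A ` M)"
    by (auto simp: union_image_def)
  also have "\<dots> = union_image \<A> M"
    unfolding union_image_def
    by (intro SUP_cong refl)
      (metis linear_image_symmetric[OF matrix_vector_mul_linear M(2)] centrally_symmetric_def)
  finally have "centrally_symmetric (union_image \<A> M)" by (simp add: centrally_symmetric_def)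
  then have "centrally_symmetric ((*\<^sub>R) c ` union_image \<A> M)"
    by (rule linear_image_symmetric[rotated]) (rule linear_scale_self)
  then have "uminus ` (M \<union> (*\<^sub>R) c ` union_image \<A> M) = M \<union> (*\<^sub>R) c ` union_image \<A> M"
    using M(2) by (simp add: centrally_symmetric_def image_Un)
  then show "centrally_symmetric ?N"
    using convex_hull_linear_image[OF linear_uminus, of "M \<union> (*\<^sub>R) c ` union_image \<A> M"]
    by (simp add: centrally_symmetric_def)
qed

lemma support_function_relaxation_step:
  assumes \<A>: "finite \<A>" "\<A> \<noteq> {}" and M: "convex_body M" and c: "c \<ge> 0"
  shows "support_function (convex hull (M \<union> (*\<^sub>R) c ` union_image \<A> M)) x =
      max (support_function M x) (c * max_image \<A> (support_function M) x)"
proof -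
  have cM: "compact M" "M \<noteq> {}" using M convex_body_nonempty[OF M] by (auto simp: convex_body_def)
  have U: "compact (union_image \<A> M)" "union_image \<A> M \<noteq> {}"
    using compact_union_image union_image_nonempty \<A> cM by blast+
  have "compact ((*\<^sub>R) c ` union_image \<A> M)" by (intro compact_scaling U)
  then show ?thesis
    using cM U by (simp add: support_function_convex_hull support_function_Un compact_imp_bounded
        support_function_scaleR[OF U c] support_function_union_image[OF \<A> cM])
qed

text \<open>The body is cut out by the half-spaces that \<open>f\<close> prescribes, so its support
  function is at most \<open>f\<close>. Equality at \<open>x\<close> needs a point touching the
  half-space; it is a cluster point of the rescaled maximizers in \<open>S n\<close>.\<close>

lemma body_of_limit_seminorm:
  fixes S :: "nat \<Rightarrow> 'a::euclidean_space set" and f :: "'a \<Rightarrow> real"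
  assumes S: "\<And>n. compact (S n)" "\<And>n. S n \<noteq> {}" and s: "\<And>n. s n > 0"
    and lim: "\<And>x. (\<lambda>n. support_function (S n) x / s n) \<longlonglongrightarrow> f x"
    and f: "seminorm_on_space f" and pos: "\<And>x. x \<noteq> 0 \<Longrightarrow> f x > 0"
  obtains K where "convex_body K" "centrally_symmetric K" "\<And>x. support_function K x = f x"
proof
  let ?K = "{y. \<forall>x. y \<bullet> x \<le> f x}"
  obtain C where C: "C > 0" "\<And>x. f x \<le> C * norm x" using seminorm_upper_bound[OF f] by blast
  obtain c where c: "c > 0" "\<And>x. c * norm x \<le> f x" using seminorm_lower_bound[OF f pos] by blast
  have K: "?K = (\<Inter>x. {y. x \<bullet> y \<le> f x})" by (auto simp: inner_commute)
  have "norm y \<le> C" if "y \<in> ?K" for y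
  proof (cases "y = 0")
    case False
    have "norm y * norm y \<le> C * norm y"
      using that C(2)[of y] by (auto simp: norm_eq_square power2_norm_eq_inner simp flip: power2_eq_square intro: order_trans)
    then show ?thesis using False by simp
  qed (use C in simp)
  then have bd: "bounded ?K" by (auto simp: bounded_iff)
  moreover have "closed ?K" unfolding K by (intro closed_INT ballI closed_halfspace_le)
  moreover have "convex ?K" unfolding K by (intro convex_INT convex_halfspace_le)
  moreover have "cball 0 c \<subseteq> ?K"
  proof clarify
    fix y x :: 'a assume "y \<in> cball 0 c"
    then have "norm y * norm x \<le> c * norm x" by (simp add: mult_right_mono)
    then show "y \<bullet> x \<le> f x" using norm_cauchy_schwarz[of y x] c(2)[of x] by linarith
  qed
  then have "0 \<in> interior ?K" using c(1) mem_interior_cball by blast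
  ultimately show "convex_body ?K" by (auto simp: convex_body_def compact_eq_bounded_closed)
  have "- y \<in> ?K" if "y \<in> ?K" for y
  proof clarify
    show "- y \<bullet> x \<le> f x" for x using that seminorm_minus[OF f, of x] by (metis inner_minus_left inner_minus_right mem_Collect_eq)
  qed
  then show "centrally_symmetric ?K" unfolding centrally_symmetric_def by (force intro: image_eqI[where x = "- _"])
  fix x
  have "\<exists>y\<in>S n. y \<bullet> x = support_function (S n) x" for n
    using support_function_attained[OF S] by metis
  then obtain y where y: "\<And>n. y n \<in> S n" "\<And>n. y n \<bullet> x = support_function (S n) x" by metis
  define w where "w n = y n /\<^sub>R s n" for n
  have w_le: "w n \<bullet> z \<le> support_function (S n) z / s n" for n z
    using support_function_upper[OF compact_imp_bounded[OF S(1)] y(1), of n z] s[of n]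
    by (simp add: w_def divide_inverse mult.commute mult_left_mono)
  have wx: "w n \<bullet> x = support_function (S n) x / s n" for n
    by (simp add: w_def y(2) divide_inverse)
  \<comment> \<open>Bounds at \<open>b\<close> and at \<open>- b\<close> control the absolute
    coordinates of \<open>w n\<close>; as \<open>G\<close> converges, the points \<open>w n\<close>
    stay in a ball.\<close>
  define G where "G n = (\<Sum>b\<in>Basis. \<bar>support_function (S n) b / s n\<bar> + \<bar>support_function (S n) (- b) / s n\<bar>)" for n
  have "G \<longlonglongrightarrow> (\<Sum>b\<in>Basis. \<bar>f b\<bar> + \<bar>f (- b)\<bar>)"
    unfolding G_def by (intro tendsto_intros lim)
  then have "Bseq G" by (intro convergent_imp_Bseq convergentI)
  then obtain B where B: "\<And>n. norm (G n) \<le> B" by (auto simp: Bseq_def)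
  have "w n \<in> cball 0 B" for n
  proof -
    have "norm (w n) \<le> (\<Sum>b\<in>Basis. \<bar>w n \<bullet> b\<bar>)" by (rule norm_le_l1)
    also have "\<dots> \<le> G n"
      unfolding G_def using w_le[of n] w_le[of n "- _"]
      by (intro sum_mono) (smt (verit, best) inner_minus_right)
    also have "\<dots> \<le> B" using B[of n] by simp
    finally show ?thesis by simp
  qed
  then obtain u r where r: "strict_mono (r :: nat \<Rightarrow> nat)" and u: "(w \<circ> r) \<longlonglongrightarrow> u"
    using compact_cball[of "0::'a" B, unfolded compact_def, rule_format, of w] by auto
  have limr: "(\<lambda>n. support_function (S (r n)) z / s (r n)) \<longlonglongrightarrow> f z" for z
    using LIMSEQ_subseq_LIMSEQ[OF lim r] by (simp add: o_def)
  have inner_lim: "(\<lambda>n. w (r n) \<bullet> z) \<longlonglongrightarrow> u \<bullet> z" for z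
    using u by (intro tendsto_intros) (simp add: o_def)
  have "u \<in> ?K"
    using LIMSEQ_le[OF inner_lim limr] w_le by blast
  moreover have "u \<bullet> x = f x"
    using LIMSEQ_unique[OF inner_lim[of x]] limr[of x] by (simp add: wx)
  ultimately have "f x \<le> support_function ?K x" using support_function_upper[OF bd, of u x] by simp
  moreover have "support_function ?K x \<le> f x"
    using \<open>u \<in> ?K\<close> by (intro support_function_least) auto
  ultimately show "support_function ?K x = f x" by simp
qed

section \<open>The joint spectral radius and Hausdorff convergence\<close>

lemma matrix_word_simps [simp]:
  "matrix_word [] = mat 1" "matrix_word (A # w) = A ** matrix_word w"
  by (simp_all add: matrix_word_def)

text \<open>With row vectors the head of the word acts first, so inductions on the word must
  generalize the vector.\<close>

lemma vector_matrix_word_Cons: "x v* matrix_word (A # w) = (x v* A) v* matrix_word w"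
  by (simp add: vector_matrix_mul_assoc)

lemma seminorm_word_le:
  fixes \<A> :: "(real^'d^'d) set" and h :: "real^'d \<Rightarrow> real"
  assumes "\<And>A x. A \<in> \<A> \<Longrightarrow> h (x v* A) \<le> q * h x" "q \<ge> 0" "set w \<subseteq> \<A>"
  shows "h (x v* matrix_word w) \<le> q ^ length w * h x"
  using assms(3)
proof (induction w arbitrary: x)
  case (Cons A w)
  have "h (x v* matrix_word (A # w)) \<le> q ^ length w * h (x v* A)"
    using Cons unfolding vector_matrix_word_Cons by simp
  also have "\<dots> \<le> q ^ length w * (q * h x)"
    using Cons.prems assms(1)[of A x] assms(2) by (intro mult_left_mono) auto
  finally show ?case by (simp add: mult_ac)
qed simp

text \<open>Greedy choice: at each vector reached, the next letter is a matrix attaining the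
  maximum.\<close>

lemma ex_word_seminorm_ge:
  assumes \<A>: "finite \<A>" "\<A> \<noteq> {}" and p: "\<And>x. p * h x \<le> max_image \<A> h x" "p \<ge> 0"
  shows "\<exists>w. set w \<subseteq> \<A> \<and> length w = n \<and> p ^ n * h x \<le> h (x v* matrix_word w)"
proof (induction n arbitrary: x)
  case (Suc n)
  obtain A where A: "A \<in> \<A>" "max_image \<A> h x = h (x v* A)"
    using max_image_attained[OF \<A>] by blast
  obtain w where w: "set w \<subseteq> \<A>" "length w = n" "p ^ n * h (x v* A) \<le> h ((x v* A) v* matrix_word w)"
    using Suc by blast
  have "p ^ Suc n * h x \<le> p ^ n * h (x v* A)"
    using mult_left_mono[OF p(1)[of x], of "p ^ n"] p(2) A(2) by (simp add: mult_ac)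
  with w(3) have "p ^ Suc n * h x \<le> h (x v* matrix_word (A # w))"
    unfolding vector_matrix_word_Cons by simp
  with w(1,2) A(1) show ?case by (intro exI[of _ "A # w"]) auto
qed simp

text \<open>One half of the equality of the operator norms of a matrix and its transpose: the
  squared norm of \<open>x v* W\<close> is the inner product of \<open>x\<close> with
  \<open>W *v (x v* W)\<close>, and one factor cancels.\<close>

lemma norm_vector_matrix_le_onorm:
  fixes W :: "real^'d^'d"
  shows "norm (x v* W) \<le> onorm ((*v) W) * norm x"
proof (cases "x v* W = 0")
  case False
  have "norm (x v* W) * norm (x v* W) = x \<bullet> (W *v (x v* W))"
    by (simp add: dot_lmul_matrix[symmetric] flip: power2_eq_square power2_norm_eq_inner)
  also have "\<dots> \<le> norm x * norm (W *v (x v* W))" by (rule norm_cauchy_schwarz)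
  also have "\<dots> \<le> norm x * (onorm ((*v) W) * norm (x v* W))"
    by (intro mult_left_mono onorm) auto
  finally have "norm (x v* W) * norm (x v* W) \<le> (onorm ((*v) W) * norm x) * norm (x v* W)"
    by (simp add: mult_ac)
  then show ?thesis by (rule mult_right_le_imp_le) (use False in simp)
qed (simp add: onorm_pos_le)

lemma onorm_le_transpose:
  fixes W :: "real^'d^'d"
  assumes "\<And>x. norm (x v* W) \<le> b * norm x"
  shows "onorm ((*v) W) \<le> b"
proof (rule onorm_le)
  fix y :: "real^'d"
  show "norm (W *v y) \<le> b * norm y"
  proof (cases "W *v y = 0")
    case True
    have "0 \<le> b * norm y" using order_trans[OF norm_ge_zero assms] .
    then show ?thesis using True by simp
  next
    case False
    have "norm (W *v y) * norm (W *v y) = ((W *v y) v* W) \<bullet> y"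
      by (simp add: dot_lmul_matrix flip: power2_eq_square power2_norm_eq_inner)
    also have "\<dots> \<le> norm ((W *v y) v* W) * norm y" by (rule norm_cauchy_schwarz)
    also have "\<dots> \<le> (b * norm (W *v y)) * norm y" by (intro mult_right_mono assms) auto
    finally have "norm (W *v y) * norm (W *v y) \<le> (b * norm y) * norm (W *v y)"
      by (simp add: mult_ac)
    then show ?thesis by (rule mult_right_le_imp_le) (use False in simp)
  qed
qed

lemma powr_const_power_root_tendsto:
  assumes "K > 0" "q \<ge> 0"
  shows "(\<lambda>n. (K * q ^ n) powr (1 / real n)) \<longlonglongrightarrow> q"
proof (rule Lim_transform_eventually)
  have "(\<lambda>n. K powr (1 / real n) * q) \<longlonglongrightarrow> K powr 0 * q"
    using assms by (intro tendsto_intros lim_1_over_n) auto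
  then show "(\<lambda>n. K powr (1 / real n) * q) \<longlonglongrightarrow> q" using assms by simp
  show "\<forall>\<^sub>F n in sequentially. K powr (1 / real n) * q = (K * q ^ n) powr (1 / real n)"
  \<comment> \<open>At index 0 the exponent \<open>1 / real n\<close> is 0 by convention, and the
    identity may fail.\<close>
  proof (rule eventually_sequentiallyI[of 1])
    fix n :: nat assume n: "1 \<le> n"
    then show "K powr (1 / real n) * q = (K * q ^ n) powr (1 / real n)"
      using assms by (cases "q = 0") (auto simp: powr_mult powr_powr simp flip: powr_realpow)
  qed
qed

text \<open>All words of length \<open>n\<close> have operator norm at most
  \<open>K * q ^ n\<close>, and some word has at least \<open>p ^ n / K\<close>. The constant
  disappears under the root of order \<open>n\<close>.\<close>

lemma joint_spectral_radius_bounds: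
  fixes \<A> :: "(real^'d^'d) set"
  assumes \<A>: "finite \<A>" "\<A> \<noteq> {}"
    and h: "seminorm_on_space h" and pos: "\<And>x. x \<noteq> 0 \<Longrightarrow> h x > 0"
    and p: "p \<ge> 0" "\<And>x. p * h x \<le> max_image \<A> h x"
    and q: "q \<ge> 0" "\<And>x. max_image \<A> h x \<le> q * h x"
  shows "p \<le> joint_spectral_radius \<A>" "joint_spectral_radius \<A> \<le> q"
proof -
  obtain C where C: "C > 0" "\<And>x. h x \<le> C * norm x" using seminorm_upper_bound[OF h] by blast
  obtain c where c: "c > 0" "\<And>x. c * norm x \<le> h x" using seminorm_lower_bound[OF h pos] by blast
  \<comment> \<open>Cost of switching between \<open>h\<close> and the Euclidean norm in both
    directions.\<close>
  define K where "K = C / c"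
  have K: "K > 0" using C c by (simp add: K_def)
  define a where "a n = (MAX w\<in>{w. set w \<subseteq> \<A> \<and> length w = n}.
      onorm ((*v) (matrix_word w)) powr (1 / real n))" for n
  have finW: "finite {w. set w \<subseteq> \<A> \<and> length w = n}" for n
    by (rule finite_lists_length_eq[OF \<A>(1)])
  have step: "h (x v* A) \<le> q * h x" if "A \<in> \<A>" for A x
    using max_image_ge[OF \<A>(1) that, of h x] q(2)[of x] by linarith
  have "onorm ((*v) (matrix_word w)) \<le> K * q ^ n" if "set w \<subseteq> \<A>" "length w = n" for w n
  proof (rule onorm_le_transpose)
    fix x :: "real^'d"
    have "c * norm (x v* matrix_word w) \<le> h (x v* matrix_word w)" by (rule c)
    also have "\<dots> \<le> q ^ n * h x" using seminorm_word_le[OF step q(1) that(1)] that(2) by simp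
    also have "\<dots> \<le> q ^ n * (C * norm x)" using q(1) C(2) by (intro mult_left_mono) auto
    finally show "norm (x v* matrix_word w) \<le> K * q ^ n * norm x"
      using c(1) by (simp add: K_def pos_le_divide_eq mult_ac)
  qed
  \<comment> \<open>The greedy word serves here only to show that the maximum ranges over a nonempty
    set.\<close>
  then have "a n \<le> (K * q ^ n) powr (1 / real n)" for n
    unfolding a_def using ex_word_seminorm_ge[OF \<A> p(2,1), of n 0] finW[of n]
    by (subst Max_le_iff) (auto intro!: powr_mono2 onorm_pos_le)
  moreover have "(inverse K * p ^ n) powr (1 / real n) \<le> a n" for n
  proof -
    obtain x :: "real^'d" where x: "norm x = 1" using vector_choose_size[of 1] by auto
    obtain w where w: "set w \<subseteq> \<A>" "length w = n" "p ^ n * h x \<le> h (x v* matrix_word w)"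
      using ex_word_seminorm_ge[OF \<A> p(2,1)] by blast
    have "p ^ n * c \<le> p ^ n * h x" using c(2)[of x] x p(1) by (intro mult_left_mono) auto
    also have "\<dots> \<le> h (x v* matrix_word w)" by (rule w)
    also have "\<dots> \<le> C * norm (x v* matrix_word w)" by (rule C)
    also have "\<dots> \<le> C * onorm ((*v) (matrix_word w))"
      using norm_vector_matrix_le_onorm[of x "matrix_word w"] x C(1) by (intro mult_left_mono) auto
    finally have "inverse K * p ^ n \<le> onorm ((*v) (matrix_word w))"
      using C(1) by (simp add: K_def pos_divide_le_eq mult_ac)
    then have "(inverse K * p ^ n) powr (1 / real n) \<le> onorm ((*v) (matrix_word w)) powr (1 / real n)"
      using K p(1) by (intro powr_mono2) auto
    also have "\<dots> \<le> a n"
      unfolding a_def using w(1,2) finW[of n] by (intro Max_ge) auto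
    finally show ?thesis .
  qed
  moreover have "limsup (\<lambda>n. ereal ((K * q ^ n) powr (1 / real n))) = ereal q"
    using powr_const_power_root_tendsto[OF K q(1)] by (intro lim_imp_Limsup) auto
  moreover have "limsup (\<lambda>n. ereal ((inverse K * p ^ n) powr (1 / real n))) = ereal p"
    using powr_const_power_root_tendsto[of "inverse K" p] K p(1) by (intro lim_imp_Limsup) auto
  ultimately have "ereal p \<le> limsup (\<lambda>n. ereal (a n))" "limsup (\<lambda>n. ereal (a n)) \<le> ereal q"
    by (metis (mono_tags, lifting) Limsup_mono always_eventually ereal_less_eq(3))+
  \<comment> \<open>The limsup is finite, being enclosed by two reals, so its conversion to a real
    is faithful.\<close>
  then show "p \<le> joint_spectral_radius \<A>" "joint_spectral_radius \<A> \<le> q"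
    unfolding joint_spectral_radius_def a_def
    by (cases "limsup (\<lambda>n. ereal (MAX w\<in>{w. set w \<subseteq> \<A> \<and> length w = n}.
        onorm ((*v) (matrix_word w)) powr (1 / real n)))"; simp)+
qed

text \<open>A zero at \<open>x \<noteq> 0\<close> would put \<open>x\<close> into the common kernel
  of the transposes. By irreducibility this invariant subspace is everything, so the joint spectral
  radius would be at most 0.\<close>

lemma lower_ratio_pos:
  fixes \<A> :: "(real^'d^'d) set"
  assumes \<A>: "finite \<A>" "\<A> \<noteq> {}" and irr: "irreducible_matrices \<A>"
    and jsr: "joint_spectral_radius \<A> > 0"
    and h: "seminorm_on_space h" and pos: "\<And>x. x \<noteq> 0 \<Longrightarrow> h x > 0"
    and "x \<noteq> 0"
  shows "max_image \<A> h x > 0"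
proof (rule ccontr)
  assume "\<not> max_image \<A> h x > 0"
  then have x: "x v* A = 0" if "A \<in> \<A>" for A
    using max_image_ge[OF \<A>(1) that, of h x] pos[of "x v* A"] by force
  define L where "L = {x. \<forall>A\<in>\<A>. x v* A = 0}"
  have "subspace L"
    by (auto simp: L_def subspace_def vector_matrix_left_distrib scaleR_vector_matrix_assoc)
  moreover have "y v* A \<in> L" if "A \<in> \<A>" "y \<in> L" for A y
    using that by (simp add: L_def)
  ultimately have "L = {0} \<or> L = UNIV" by (rule irreducible_left_invariant[OF irr])
  then have "L = UNIV" using x \<open>x \<noteq> 0\<close> by (auto simp: L_def)
  then have z: "y v* A = 0" if "A \<in> \<A>" for y A using that by (auto simp: L_def)
  have "max_image \<A> h y = 0" for y
    using max_image_attained[OF \<A>, of h y] z seminorm_zero[OF h] by metis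
  then have "joint_spectral_radius \<A> \<le> 0"
    by (intro joint_spectral_radius_bounds(2)[OF \<A> h pos, of 0]) auto
  with jsr show False by simp
qed

section \<open>Hausdorff estimates for bodies enclosed between multiples of a fixed body\<close>

lemma hausdorff_dist_le:
  assumes "S \<noteq> {}" "T \<noteq> {}"
    and S: "\<And>x. x \<in> S \<Longrightarrow> \<exists>y\<in>T. dist x y \<le> r" and T: "\<And>y. y \<in> T \<Longrightarrow> \<exists>x\<in>S. dist y x \<le> r"
  shows "0 \<le> hausdorff_dist S T" "hausdorff_dist S T \<le> r"
proof -
  have S': "infdist x T \<le> r" if "x \<in> S" for x using S[OF that] infdist_le2 by blast
  have T': "infdist y S \<le> r" if "y \<in> T" for y using T[OF that] infdist_le2 by blast
  show "hausdorff_dist S T \<le> r"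
    unfolding hausdorff_dist_def using assms(1,2) S' T' by (intro max.boundedI cSUP_least)
  obtain x where x: "x \<in> S" using assms(1) by blast
  have "0 \<le> infdist x T" by (rule infdist_nonneg)
  \<comment> \<open>A supremum of reals dominates its members only if they are bounded above;
    \<open>r\<close> is such a bound.\<close>
  also have "\<dots> \<le> (SUP x\<in>S. infdist x T)" using S' x by (intro cSUP_upper bdd_aboveI2)
  finally show "0 \<le> hausdorff_dist S T" by (simp add: hausdorff_dist_def)
qed

text \<open>For \<open>c > 1\<close> the point \<open>e\<close> would lie strictly between the
  interior point 0 and a point of \<open>M\<close>, hence in the interior.\<close>

lemma frontier_ray_bound:
  fixes M :: "'a::euclidean_space set"
  assumes "convex M" "0 \<in> interior M" "e \<in> frontier M" "c *\<^sub>R e \<in> M"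
  shows "c \<le> 1"
proof (rule ccontr)
  assume c: "\<not> c \<le> 1"
  then have "c *\<^sub>R e - (1 - 1/c) *\<^sub>R (c *\<^sub>R e - 0) \<in> interior M"
    using assms by (intro mem_interior_convex_shrink) auto
  then have "e \<in> interior M" using c by (simp add: algebra_simps)
  then show False using assms(3) by (simp add: frontier_def)
qed

lemma scaleR_image_mono:
  fixes K :: "'a::real_vector set"
  assumes "convex K" "0 \<in> K" "0 \<le> s" "s \<le> t" shows "(*\<^sub>R) s ` K \<subseteq> (*\<^sub>R) t ` K"
proof (cases "t = 0")
  case False
  then have t: "t > 0" using assms by simp
  show ?thesis
  proof clarify
    fix k assume "k \<in> K"
    then have "(s / t) *\<^sub>R k + (1 - s / t) *\<^sub>R 0 \<in> K"
      using assms t by (intro convexD) auto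
    then have "t *\<^sub>R ((s / t) *\<^sub>R k) \<in> (*\<^sub>R) t ` K" by (intro imageI) simp
    then show "s *\<^sub>R k \<in> (*\<^sub>R) t ` K" using t by simp
  qed
qed (use assms in auto)

lemma hausdorff_dist_sandwich:
  fixes K S :: "'a::euclidean_space set"
  assumes K: "K \<noteq> {}" "K \<subseteq> cball 0 R" and b: "b \<ge> 1"
    and S: "(*\<^sub>R) (1 / b) ` K \<subseteq> S" "S \<subseteq> (*\<^sub>R) b ` K"
  shows "0 \<le> hausdorff_dist S K" "hausdorff_dist S K \<le> (b - 1) * R"
proof -
  have R: "norm k \<le> R" if "k \<in> K" for k using that K(2) by auto
  have "S \<noteq> {}" using S(1) K(1) by blast
  moreover have "\<exists>y\<in>K. dist x y \<le> (b - 1) * R" if "x \<in> S" for x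
  proof -
    from that S(2) obtain k where k: "k \<in> K" "x = b *\<^sub>R k" by blast
    have "x - k = (b - 1) *\<^sub>R k" by (simp add: k algebra_simps)
    then have "dist x k = (b - 1) * norm k" using b by (simp add: dist_norm)
    then show ?thesis using k(1) R[OF k(1)] b by (intro bexI[of _ k]) (simp_all add: mult_left_mono)
  qed
  moreover have "\<exists>x\<in>S. dist y x \<le> (b - 1) * R" if "y \<in> K" for y
  proof -
    have "y - (1 / b) *\<^sub>R y = (1 - 1 / b) *\<^sub>R y" by (simp add: algebra_simps)
    then have "dist y ((1 / b) *\<^sub>R y) = (1 - 1 / b) * norm y" using b by (simp add: dist_norm)
    also have "\<dots> \<le> (b - 1) * norm y"
    proof (intro mult_right_mono)
      \<comment> \<open>After multiplication by \<open>b\<close>, the claim is exactly this square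
        inequality.\<close>
      have "0 \<le> (b - 1) * (b - 1)" using b by simp
      then show "1 - 1 / b \<le> b - 1" using b by (simp add: field_simps)
    qed simp
    also have "\<dots> \<le> (b - 1) * R" using b R[OF that] by (intro mult_left_mono) auto
    finally show ?thesis using S(1) that by blast
  qed
  ultimately show "0 \<le> hausdorff_dist S K" "hausdorff_dist S K \<le> (b - 1) * R"
    using hausdorff_dist_le[OF _ K(1)] by blast+
qed

lemma convex_body_scaleR:
  fixes M :: "'a::euclidean_space set"
  assumes "convex_body M" "c \<noteq> 0" shows "convex_body ((*\<^sub>R) c ` M)"
proof -
  have "interior ((*\<^sub>R) c ` M) = (*\<^sub>R) c ` interior M"
    using assms(2) by (intro interior_injective_linear_image linear_scale_self) (auto intro: injI)
  then show ?thesis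
    using assms by (auto simp: convex_body_def intro: compact_scaling convex_scaling)
qed

text \<open>Since \<open>e\<close> lies on the frontier of both \<open>M\<close> and
  \<open>K\<close> scaled by \<open>1 / d\<close>, the unknown scale is pinned down by
  \<open>a * c \<le> 1 / d \<le> b * c\<close>. This eliminates \<open>c\<close> and leaves only the
  ratio \<open>b / a\<close>.\<close>

lemma hausdorff_dist_normalized_bound:
  fixes K M :: "'a::euclidean_space set"
  assumes K: "convex_body K" "0 \<in> interior K" "K \<subseteq> cball 0 R" "d *\<^sub>R e \<in> frontier K" "d > 0"
    and M: "convex_body M" "0 \<in> interior M" "e \<in> frontier M"
    and ab: "0 < a" "a \<le> b" "c > 0"
    and sand: "(*\<^sub>R) (a * c) ` K \<subseteq> M" "M \<subseteq> (*\<^sub>R) (b * c) ` K"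
  shows "0 \<le> hausdorff_dist M ((*\<^sub>R) (1 / d) ` K)"
    and "hausdorff_dist M ((*\<^sub>R) (1 / d) ` K) \<le> (b / a - 1) * (R / d)"
proof -
  let ?L = "(*\<^sub>R) (1 / d) ` K"
  have cvK: "convex K" "closed K" and cvM: "convex M" "closed M"
    using K(1) M(1) by (auto simp: convex_body_def compact_imp_closed)
  have K0: "0 \<in> K" using K(2) interior_subset by blast
  have "e \<in> M" using M(3) cvM(2) by (simp add: frontier_def)
  then obtain k where k: "k \<in> K" "e = (b * c) *\<^sub>R k" using sand(2) by blast
  have bc: "b * c > 0" using ab by simp
  have "(1 / (b * c)) *\<^sub>R (d *\<^sub>R e) = d *\<^sub>R k" using ab k(2) by simp
  moreover have "(1 / (b * c * d)) *\<^sub>R (d *\<^sub>R e) = (1 / d) *\<^sub>R ((1 / (b * c)) *\<^sub>R (d *\<^sub>R e))"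
    by simp
  ultimately have "(1 / (b * c * d)) *\<^sub>R (d *\<^sub>R e) \<in> K"
    using k(1) K(5) by simp
  then have "1 / (b * c * d) \<le> 1" by (rule frontier_ray_bound[OF cvK(1) K(2,4)])
  then have "1 \<le> b * c * d" using bc K(5) by (subst (asm) pos_divide_le_eq) simp_all
  then have low: "1 / d \<le> b * c" using K(5) by (simp add: pos_divide_le_eq)
  have "d *\<^sub>R e \<in> K" using K(4) cvK(2) by (simp add: frontier_def)
  then have "(a * c) *\<^sub>R (d *\<^sub>R e) \<in> M" using sand(1) by blast
  then have "(a * c * d) *\<^sub>R e \<in> M" by simp
  from frontier_ray_bound[OF cvM(1) M(2,3) this]
  have up: "a * c \<le> 1 / d" using K(5) by (simp add: field_simps)
  have "(*\<^sub>R) (1 / (b / a)) ` ?L = (*\<^sub>R) (a / b * (1 / d)) ` K"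
    by (simp add: image_image)
  also have "\<dots> \<subseteq> (*\<^sub>R) (a * c) ` K"
    using low ab K(5) by (intro scaleR_image_mono cvK K0) (auto simp: field_simps)
  also have "\<dots> \<subseteq> M" by (rule sand)
  finally have 1: "(*\<^sub>R) (1 / (b / a)) ` ?L \<subseteq> M" .
  have "M \<subseteq> (*\<^sub>R) (b * c) ` K" by (rule sand)
  also have "\<dots> \<subseteq> (*\<^sub>R) (b / a * (1 / d)) ` K"
    using up ab K(5) bc by (intro scaleR_image_mono cvK K0) (auto simp: field_simps)
  also have "\<dots> = (*\<^sub>R) (b / a) ` ?L" by (simp add: image_image)
  finally have 2: "M \<subseteq> (*\<^sub>R) (b / a) ` ?L" .
  have "?L \<noteq> {}" using K0 by blast
  moreover have "?L \<subseteq> cball 0 (R / d)"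
    using K(3,5) by (auto simp: divide_right_mono)
  moreover have "b / a \<ge> 1" using ab by simp
  ultimately show "0 \<le> hausdorff_dist M ?L" "hausdorff_dist M ?L \<le> (b / a - 1) * (R / d)"
    using hausdorff_dist_sandwich[of ?L "R / d" "b / a" M] 1 2 by blast+
qed

section \<open>Return from norms to convex bodies and their Hausdorff convergence\<close>

theorem theorem3p2:
  fixes \<A> :: "(real^'d^'d) set"
    and \<gamma> :: "real \<Rightarrow> real \<Rightarrow> real"
    and M\<^sub>0 :: "(real^'d) set"
    and e :: "real^'d"
    and \<mu> :: "nat \<Rightarrow> real"
    and M :: "nat \<Rightarrow> (real^'d) set"
  assumes "finite \<A>" and "\<A> \<noteq> {}"
    and "irreducible_matrices \<A>"
    and "joint_spectral_radius \<A> > 0"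
    and "averaging_function \<gamma>"
    and "convex_body M\<^sub>0" and "centrally_symmetric M\<^sub>0"
    and "e \<noteq> 0"
    and M: "M = relax_body \<A> \<gamma> M\<^sub>0"
    and \<mu>: "\<And>n. \<mu> (Suc n) > 0 \<and> e \<in> frontier ((*\<^sub>R) (\<mu> (Suc n)) ` M (Suc n))"
  shows "((\<lambda>n. rho_plus \<A> (M n)) \<longlonglongrightarrow> joint_spectral_radius \<A> \<and>
          (\<lambda>n. rho_minus \<A> (M n)) \<longlonglongrightarrow> joint_spectral_radius \<A>) \<and>
         ((\<forall>n\<ge>1. convex_body ((*\<^sub>R) (\<mu> n) ` M n) \<and> centrally_symmetric ((*\<^sub>R) (\<mu> n) ` M n)) \<and>
          (\<exists>M'. DK_body \<A> M' \<and>
             (\<lambda>n. hausdorff_dist ((*\<^sub>R) (\<mu> n) ` M n) M') \<longlonglongrightarrow> 0)) \<and>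
         (incseq (\<lambda>n. rho_minus \<A> (M n)) \<and> decseq (\<lambda>n. rho_plus \<A> (M n)) \<and>
          (\<forall>n\<ge>1. rho_minus \<A> (M n) \<le> joint_spectral_radius \<A> \<and>
                  joint_spectral_radius \<A> \<le> rho_plus \<A> (M n)))"
proof -
  note \<A> = assms(1,2) and irr = assms(3) and jsr = assms(4) and avg = assms(5)
  define h where "h n = support_function (M n)" for n
  define p where "p n = rho_minus \<A> (M n)" for n
  define q where "q n = rho_plus \<A> (M n)" for n
  let ?\<rho> = "joint_spectral_radius \<A>"
  have M_Suc: "M (Suc n) = convex hull (M n \<union> (*\<^sub>R) (inverse (\<gamma> (p n) (q n))) ` union_image \<A> (M n))" for n
    by (simp add: M p_def q_def Let_def)
  have body: "convex_body (M n)" "centrally_symmetric (M n)" for n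
  proof (induction n)
    case 0
    { case 1 show ?case by (simp add: M assms) next case 2 show ?case by (simp add: M assms) }
  next
    case (Suc n)
    { case 1 show ?case unfolding M_Suc by (rule relaxation_step_body[OF \<A>(1) Suc])
      next case 2 show ?case unfolding M_Suc by (rule relaxation_step_body[OF \<A>(1) Suc]) }
  qed
  have sn: "seminorm_on_space (h n)" for n
    unfolding h_def by (rule seminorm_support_function[OF body])
  have pos: "h n x > 0" if "x \<noteq> 0" for n x
    unfolding h_def by (rule support_function_pos[OF body that])
  note rho = rho_minus_characterization[OF \<A> body, folded h_def p_def]
    rho_plus_characterization[OF \<A> body, folded h_def q_def]
  \<comment> \<open>Positivity of the lower bound is where a positive joint spectral radius is
    needed; it keeps the arguments of \<open>\<gamma>\<close> in its domain.\<close>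
  have p_pos: "p n > 0" for n
  proof -
    obtain x where x: "x \<noteq> 0" "max_image \<A> (h n) x = p n * h n x" using rho(3) by blast
    have "p n * h n x > 0" using lower_ratio_pos[OF \<A> irr jsr sn pos x(1), of n] x(2) by simp
    then show ?thesis using pos[OF x(1), of n] by (simp add: zero_less_mult_iff)
  qed
  have bounds: "p n \<le> ?\<rho>" "?\<rho> \<le> q n" for n
    using joint_spectral_radius_bounds[OF \<A> sn pos rho(1,2,4,5)] by blast+
  have \<gamma>_pos: "\<gamma> (p n) (q n) > 0" for n
    using averaging_between(1)[OF avg p_pos[of n], of "q n"] bounds[of n] p_pos[of n] by linarith
  have step: "h (Suc n) x = max (h n x) (max_image \<A> (h n) x / \<gamma> (p n) (q n))" for n x
    using support_function_relaxation_step[OF \<A> body(1), of "inverse (\<gamma> (p n) (q n))" n x] \<gamma>_pos[of n]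
    by (simp add: h_def M_Suc divide_inverse mult.commute)
  interpret relaxation \<A> \<gamma> h p q ?\<rho>
    by unfold_locales (erule pos | rule \<A> irr avg sn rho(2,3,5,6) p_pos bounds step)+
  obtain f r s where f: "seminorm_on_space f" "\<And>x. x \<noteq> 0 \<Longrightarrow> f x > 0"
    and Tf: "\<And>x. max_image \<A> f x = ?\<rho> * f x" and s: "\<And>n. s n > 0"
    and lim: "\<And>x. (\<lambda>n. h (r n) x / s n) \<longlonglongrightarrow> f x"
    and sandwich: "\<And>e. 0 < e \<Longrightarrow> e < 1 \<Longrightarrow> \<exists>N. \<forall>n\<ge>N. \<exists>c>0. \<forall>x.
        (1 - e) * c * f x \<le> h n x \<and> h n x \<le> (1 + e) * c * f x"
    by (rule eventual_sandwich) (rule that)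
  have cM: "compact (M n)" "convex (M n)" "M n \<noteq> {}" for n
    using body(1)[of n] convex_body_nonempty[OF body(1)] by (auto simp: convex_body_def)
  obtain K where K: "convex_body K" "centrally_symmetric K" "\<And>x. support_function K x = f x"
    by (rule body_of_limit_seminorm[of "\<lambda>n. M (r n)" s f])
      (use cM s lim f that in \<open>simp_all add: h_def\<close>)
  have cK: "compact K" "convex K" "K \<noteq> {}"
    using K(1) convex_body_nonempty[OF K(1)] by (auto simp: convex_body_def)
  have scK: "compact ((*\<^sub>R) u ` K)" "convex ((*\<^sub>R) u ` K)" "(*\<^sub>R) u ` K \<noteq> {}" for u
    using cK by (auto intro: compact_scaling convex_scaling)
  have sfK: "support_function ((*\<^sub>R) u ` K) x = u * f x" if "u \<ge> 0" for u x
    using support_function_scaleR[OF cK(1,3) that] by (simp add: K(3))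
  have K0: "0 \<in> interior K" by (rule symmetric_convex_body_0[OF K(1,2)])
  \<comment> \<open>The eigenvalue equation makes \<open>?\<rho>\<close> an admissible factor for
    both inclusions.\<close>
  have DK: "(*\<^sub>R) ?\<rho> ` K = convex hull (union_image \<A> K)"
    using image_subset_scaleR_iff[OF \<A> K(1), of ?\<rho>] jsr Tf K(3)
    by (intro antisym) (simp_all add: ext[OF K(3)])
  \<comment> \<open>Scaling \<open>K\<close> by \<open>1 / d\<close> places \<open>e\<close> on its
    frontier, the same normalization as for the iterated bodies.\<close>
  obtain d where d: "d > 0" "d *\<^sub>R e \<in> frontier K"
    using ray_to_frontier[OF compact_imp_bounded[OF cK(1)] K0 \<open>e \<noteq> 0\<close>] by auto
  obtain R where R: "R > 0" "K \<subseteq> cball 0 R"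
    using compact_imp_bounded[OF cK(1)] by (auto simp: bounded_pos subset_eq)
  let ?K = "(*\<^sub>R) (1 / d) ` K"
  \<comment> \<open>The scalar \<open>\<mu> 0\<close> is unconstrained, so normalization is
    available only from index 1 on.\<close>
  have star: "convex_body ((*\<^sub>R) (\<mu> n) ` M n)" "centrally_symmetric ((*\<^sub>R) (\<mu> n) ` M n)"
    "\<mu> n > 0" "e \<in> frontier ((*\<^sub>R) (\<mu> n) ` M n)" if "n \<ge> 1" for n
  proof -
    obtain m where m: "n = Suc m" using \<open>n \<ge> 1\<close> by (cases n) auto
    show "\<mu> n > 0" "e \<in> frontier ((*\<^sub>R) (\<mu> n) ` M n)" using \<mu>[of m] m by auto
    then show "convex_body ((*\<^sub>R) (\<mu> n) ` M n)" "centrally_symmetric ((*\<^sub>R) (\<mu> n) ` M n)"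
      using convex_body_scaleR[OF body(1)] linear_image_symmetric[OF linear_scale_self body(2)] by auto
  qed
  have bound: "\<exists>N. \<forall>n\<ge>N. 0 \<le> hausdorff_dist ((*\<^sub>R) (\<mu> n) ` M n) ?K \<and>
      hausdorff_dist ((*\<^sub>R) (\<mu> n) ` M n) ?K \<le> ((1 + t) / (1 - t) - 1) * (R / d)"
    if t: "0 < t" "t < 1" for t
  proof -
    obtain N where N: "\<And>n. n \<ge> N \<Longrightarrow> \<exists>c>0. \<forall>x. (1 - t) * c * f x \<le> h n x \<and> h n x \<le> (1 + t) * c * f x"
      using sandwich[OF t] by blast
    have "0 \<le> hausdorff_dist ((*\<^sub>R) (\<mu> n) ` M n) ?K \<and>
      hausdorff_dist ((*\<^sub>R) (\<mu> n) ` M n) ?K \<le> ((1 + t) / (1 - t) - 1) * (R / d)"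
      if n: "n \<ge> max 1 N" for n
    proof -
      obtain c where c: "c > 0" "\<And>x. (1 - t) * c * f x \<le> h n x" "\<And>x. h n x \<le> (1 + t) * c * f x"
        using N[of n] n by auto
      have sub: "(*\<^sub>R) ((1 - t) * c) ` K \<subseteq> M n" "M n \<subseteq> (*\<^sub>R) ((1 + t) * c) ` K"
        using subset_iff_support_function[OF compact_imp_bounded[OF scK(1)] scK(3) cM]
          subset_iff_support_function[OF compact_imp_bounded[OF cM(1)] cM(3) scK] c t
        by (simp_all add: sfK flip: h_def)
      have n1: "n \<ge> 1" using n by simp
      \<comment> \<open>The normalizing factor \<open>\<mu> n\<close> is absorbed into
        \<open>c\<close>; the ratio of the outer and inner factors is unchanged.\<close>
      have "(*\<^sub>R) ((1 - t) * (c * \<mu> n)) ` K = (*\<^sub>R) (\<mu> n) ` (*\<^sub>R) ((1 - t) * c) ` K"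
        by (simp add: image_image mult_ac)
      also have "\<dots> \<subseteq> (*\<^sub>R) (\<mu> n) ` M n" by (intro image_mono sub)
      finally have 1: "(*\<^sub>R) ((1 - t) * (c * \<mu> n)) ` K \<subseteq> (*\<^sub>R) (\<mu> n) ` M n" .
      have "(*\<^sub>R) (\<mu> n) ` M n \<subseteq> (*\<^sub>R) (\<mu> n) ` (*\<^sub>R) ((1 + t) * c) ` K" by (intro image_mono sub)
      also have "\<dots> = (*\<^sub>R) ((1 + t) * (c * \<mu> n)) ` K"
        by (simp add: image_image mult_ac)
      finally have 2: "(*\<^sub>R) (\<mu> n) ` M n \<subseteq> (*\<^sub>R) ((1 + t) * (c * \<mu> n)) ` K" .
      have ct: "0 < 1 - t" "1 - t \<le> 1 + t" "c * \<mu> n > 0" using t c(1) star(3)[OF n1] by auto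
      show ?thesis
        using hausdorff_dist_normalized_bound[OF K(1) K0 R(2) d(2,1) star(1)[OF n1]
            symmetric_convex_body_0[OF star(1,2)[OF n1]] star(4)[OF n1] ct 1 2] by blast
    qed
    then show ?thesis by blast
  qed
  have "(\<lambda>n. hausdorff_dist ((*\<^sub>R) (\<mu> n) ` M n) ?K) \<longlonglongrightarrow> 0"
  proof (rule LIMSEQ_I)
    fix \<epsilon> :: real assume \<epsilon>: "\<epsilon> > 0"
    \<comment> \<open>The bound tends to 0 as \<open>t\<close> decreases to 0, so a suitable
      \<open>t\<close> in the unit interval exists for each \<open>\<epsilon>\<close>.\<close>
    have "((\<lambda>t. ((1 + t) / (1 - t) - 1) * (R / d)) \<longlongrightarrow> ((1 + 0) / (1 - 0) - 1) * (R / d)) (at_right 0)"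
      by (intro tendsto_intros) auto
    then have "\<forall>\<^sub>F t in at_right 0. ((1 + t) / (1 - t) - 1) * (R / d) < \<epsilon>"
      using \<epsilon> by (intro order_tendstoD(2)) auto
    moreover have "\<forall>\<^sub>F t in at_right (0::real). 0 < t \<and> t < 1"
      by (auto simp: eventually_at_right_field intro: exI[of _ 1])
    ultimately obtain t where t: "0 < t" "t < 1" "((1 + t) / (1 - t) - 1) * (R / d) < \<epsilon>"
      using eventually_happens'[OF trivial_limit_at_right_real eventually_conj] by blast
    obtain N where N: "\<And>n. n \<ge> N \<Longrightarrow> 0 \<le> hausdorff_dist ((*\<^sub>R) (\<mu> n) ` M n) ?K"
      "\<And>n. n \<ge> N \<Longrightarrow> hausdorff_dist ((*\<^sub>R) (\<mu> n) ` M n) ?K \<le> ((1 + t) / (1 - t) - 1) * (R / d)"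
      using bound[OF t(1,2)] by blast
    have "norm (hausdorff_dist ((*\<^sub>R) (\<mu> n) ` M n) ?K - 0) < \<epsilon>" if "n \<ge> N" for n
      using N(1)[OF that] le_less_trans[OF N(2)[OF that] t(3)] by simp
    then show "\<exists>no. \<forall>n\<ge>no. norm (hausdorff_dist ((*\<^sub>R) (\<mu> n) ` M n) ?K - 0) < \<epsilon>" by blast
  qed
  moreover have "DK_body \<A> ?K"
    unfolding DK_body_def
  proof (intro conjI exI)
    show "convex_body ?K" using K(1) d(1) by (intro convex_body_scaleR) auto
    have "union_image \<A> ?K = (*\<^sub>R) (1 / d) ` union_image \<A> K"
      by (simp add: union_image_def image_UN image_image matrix_vector_mult_scaleR)
    then have "convex hull (union_image \<A> ?K) = (*\<^sub>R) (1 / d) ` (*\<^sub>R) ?\<rho> ` K"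
      by (simp only: convex_hull_scaling DK)
    then show "(*\<^sub>R) ?\<rho> ` ?K = convex hull (union_image \<A> ?K)"
      by (simp add: image_image mult.commute)
    show "?\<rho> > 0" by (rule jsr)
  qed
  ultimately show ?thesis
    using p_tendsto q_tendsto p_incseq q_decseq bounds star(1,2)
    unfolding p_def[abs_def] q_def[abs_def] by blast
qed

end
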